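(* Let $\mathscr A$ be a $C^*$-algebra and $\mathscr E$ a Hilbert $\mathscr A$-module. Let $A,B\in\mathcal L(\mathscr E)$ be such that $\overline{\mathscr R(A^* )}$ and $\overline{\mathscr R(B^* )}$ are orthogonally complemented submodules of $\mathscr E$. Then the following assertions are equivalent: (i) The operator equation $AX=B$ has a solution $X\in\mathcal L(\mathscr E)$. (ii) $\mathscr R(B)\subseteq\mathscr R(A)$. (iii) $\mathscr R(A)\supseteq\mathscr R(BB^* )$ and $BB^*\leq\lambda AA^*$ for some scalar $\lambda>0$.
   Context: $\mathcal L(\mathscr E)$ is the $C^*$-algebra of adjointable operators on $\mathscr E$; $\mathscr R(T)$ denotes the range of $T$. A closed submodule $\mathscr M\subseteq\mathscr E$ is orthogonally complemented if $\mathscr E=\mathscr M\oplus\mathscr M^\perp$. *)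

theory Defs
  imports "HOL-Analysis.Analysis"
begin

class complex_vector = real_vector +
  fixes scaleC :: "complex \<Rightarrow> 'a \<Rightarrow> 'a"  (infixr "*\<^sub>C" 75)
  assumes scaleC_add_right: "z *\<^sub>C (x + y) = z *\<^sub>C x + z *\<^sub>C y"
    and scaleC_add_left: "(z + w) *\<^sub>C x = z *\<^sub>C x + w *\<^sub>C x"
    and scaleC_scaleC: "z *\<^sub>C w *\<^sub>C x = (z * w) *\<^sub>C x"
    and scaleR_scaleC: "r *\<^sub>R x = complex_of_real r *\<^sub>C x"

class complex_normed_vector = complex_vector + real_normed_vector +
  assumes norm_scaleC: "norm (z *\<^sub>C x) = cmod z * norm x"

class complex_banach = complex_normed_vector + banach

text \<open>No unit is required, and the zero algebra is allowed.\<close>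

class cstar_algebra = complex_banach + real_normed_algebra +
  fixes star :: "'a \<Rightarrow> 'a"
  assumes mult_scaleC_left: "(z *\<^sub>C x) * y = z *\<^sub>C (x * y)"
    and mult_scaleC_right: "x * (z *\<^sub>C y) = z *\<^sub>C (x * y)"
    and star_add: "star (x + y) = star x + star y"
    and star_scaleC: "star (z *\<^sub>C x) = cnj z *\<^sub>C star x"
    and star_mult: "star (x * y) = star y * star x"
    and star_star: "star (star x) = x"
    and cstar_identity: "norm (star x * x) = (norm x)\<^sup>2"

definition positive_element :: "'a::cstar_algebra \<Rightarrow> bool" where
  "positive_element a \<longleftrightarrow> (\<exists>b. a = star b * b)"

text \<open>
  Right Hilbert modules, with inner product linear in the second variable. The norm of the module
  type is required to be the one induced by the inner product, so that the class
  \<^class>\<open>complex_banach\<close> expresses completeness for that norm.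
\<close>

locale hilbert_module =
  fixes act :: "'e::complex_banach \<Rightarrow> 'a::cstar_algebra \<Rightarrow> 'e"
    and ip :: "'e \<Rightarrow> 'e \<Rightarrow> 'a"
  assumes act_add_left: "act (x + y) a = act x a + act y a"
    and act_add_right: "act x (a + b) = act x a + act x b"
    and act_mult: "act x (a * b) = act (act x a) b"
    and act_scaleC_left: "act (z *\<^sub>C x) a = z *\<^sub>C act x a"
    and act_scaleC_right: "act x (z *\<^sub>C a) = z *\<^sub>C act x a"
    and ip_add_right: "ip x (y + y') = ip x y + ip x y'"
    and ip_scaleC_right: "ip x (z *\<^sub>C y) = z *\<^sub>C ip x y"
    and ip_act_right: "ip x (act y a) = ip x y * a"
    and star_ip: "star (ip x y) = ip y x"
    and ip_self_positive: "positive_element (ip x x)"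
    and ip_self_eq_0: "ip x x = 0 \<Longrightarrow> x = 0"
    and norm_eq_sqrt_ip: "norm x = sqrt (norm (ip x x))"

text \<open>
  As usual, adjointable operators are arbitrary maps possessing an adjoint; their linearity,
  \<open>'a\<close>-linearity and boundedness are consequences.
\<close>

definition is_adjoint :: "('e \<Rightarrow> 'e \<Rightarrow> 'a) \<Rightarrow> ('e \<Rightarrow> 'e) \<Rightarrow> ('e \<Rightarrow> 'e) \<Rightarrow> bool" where
  "is_adjoint ip T S \<longleftrightarrow> (\<forall>x y. ip (T x) y = ip x (S y))"

definition adjointable_ops :: "('e \<Rightarrow> 'e \<Rightarrow> 'a) \<Rightarrow> ('e \<Rightarrow> 'e) set" where
  "adjointable_ops ip = {T. \<exists>S. is_adjoint ip T S}"

definition adj :: "('e \<Rightarrow> 'e \<Rightarrow> 'a) \<Rightarrow> ('e \<Rightarrow> 'e) \<Rightarrow> 'e \<Rightarrow> 'e" where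
  "adj ip T = (THE S. is_adjoint ip T S)"

text \<open>
  Positivity in the \<open>C\<^sup>*\<close>-algebra of adjointable operators is the same notion as
  \<^const>\<open>positive_element\<close>, with product and involution given by composition and adjoint.
\<close>

definition positive_op :: "('e \<Rightarrow> 'e \<Rightarrow> 'a) \<Rightarrow> ('e \<Rightarrow> 'e) \<Rightarrow> bool" where
  "positive_op ip T \<longleftrightarrow> (\<exists>S\<in>adjointable_ops ip. T = adj ip S \<circ> S)"

definition op_le :: "('e \<Rightarrow> 'e \<Rightarrow> 'a) \<Rightarrow> ('e \<Rightarrow> 'e::minus) \<Rightarrow> ('e \<Rightarrow> 'e) \<Rightarrow> bool" where
  "op_le ip S T \<longleftrightarrow> positive_op ip (\<lambda>x. T x - S x)"

definition closed_submodule :: "('e::complex_normed_vector \<Rightarrow> 'a \<Rightarrow> 'e) \<Rightarrow> 'e set \<Rightarrow> bool" where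
  "closed_submodule act M \<longleftrightarrow> closed M \<and> 0 \<in> M \<and> (\<forall>x\<in>M. \<forall>y\<in>M. x + y \<in> M) \<and>
     (\<forall>z. \<forall>x\<in>M. z *\<^sub>C x \<in> M) \<and> (\<forall>x\<in>M. \<forall>a. act x a \<in> M)"

definition orth_compl :: "('e \<Rightarrow> 'e \<Rightarrow> 'a::zero) \<Rightarrow> 'e set \<Rightarrow> 'e set" where
  "orth_compl ip M = {y. \<forall>x\<in>M. ip x y = 0}"

definition orthogonally_complemented ::
    "('e::complex_normed_vector \<Rightarrow> 'a::zero \<Rightarrow> 'e) \<Rightarrow> ('e \<Rightarrow> 'e \<Rightarrow> 'a) \<Rightarrow> 'e set \<Rightarrow> bool" where
  "orthogonally_complemented act ip M \<longleftrightarrow> closed_submodule act M \<and>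
     {x + y |x y. x \<in> M \<and> y \<in> orth_compl ip M} = UNIV \<and> M \<inter> orth_compl ip M = {0}"

context hilbert_module
begin

lemma adj_eqI:
  assumes "is_adjoint ip T S"
  shows "adj ip T = S"
  unfolding adj_def
proof (rule the_equality)
  show "is_adjoint ip T S"
    by (rule assms)
next
  fix S' assume S': "is_adjoint ip T S'"
  show "S' = S"
  proof
    fix y
    have "ip x (S' y) = ip x (S y)" for x
      using S' assms by (metis is_adjoint_def)
    moreover have "ip x (S' y) = ip x (S' y - S y) + ip x (S y)" for x
      by (metis diff_add_cancel ip_add_right)
    ultimately have "ip (S' y - S y) (S' y - S y) = 0"
      by simp
    then show "S' y = S y"
      using ip_self_eq_0 by fastforce
  qed
qed

lemma is_adjoint_adj: "T \<in> adjointable_ops ip \<Longrightarrow> is_adjoint ip T (adj ip T)"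
  using adj_eqI by (auto simp: adjointable_ops_def)

end

end

theory Submission
  imports Defs
begin

text \<open>
  Let \<open>M\<close> be the closure of the range of \<open>A\<^sup>*\<close>. Its orthogonal complement is killed by \<open>A\<close>, and
  together with \<open>M\<close> it spans the module, so every element of the range of \<open>A\<close> has a preimage in \<open>M\<close>. All three conditions are linked by the
  inequality \<open>\<parallel>B\<^sup>* y\<parallel> \<le> K \<parallel>A\<^sup>* y\<parallel>\<close>.

  If the range of \<open>B\<close> lies in that of \<open>A\<close>, choose \<open>X x \<in> M\<close> with \<open>A (X x) = B x\<close>. The adjoint of \<open>X\<close>
  should send \<open>A\<^sup>* y\<close> to \<open>B\<^sup>* y\<close> and vanish on the complement of \<open>M\<close>; it extends from the range of \<open>A\<^sup>*\<close>
  to \<open>M\<close> because of the inequality, which here is the uniform boundedness principle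
  (\<open>adjoint_dominated_of_range_subset\<close>, \<open>adjointable_solution_of_range_subset\<close>).

  If \<open>B = A X\<close>, then \<open>c A A\<^sup>* - B B\<^sup>* = A (c - X X\<^sup>*) A\<^sup>*\<close>, and for large \<open>c\<close> the middle factor has a
  self-adjoint square root (\<open>op_le_of_factorization\<close>).

  If \<open>B B\<^sup>* \<le> c A A\<^sup>*\<close>, then \<open>\<langle>B\<^sup>* y, B\<^sup>* y\<rangle>\<close> is at most \<open>c \<langle>A\<^sup>* y, A\<^sup>* y\<rangle>\<close> in the coefficient algebra,
  and the inequality holds because the norm of a \<open>C\<^sup>*\<close>-algebra is monotone on positive elements. The
  range of \<open>B B\<^sup>*\<close> being in that of \<open>A\<close>, each \<open>B B\<^sup>* z\<close> has a preimage in \<open>M\<close> whose norm is at most a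
  multiple of \<open>\<parallel>B\<^sup>* z\<parallel>\<close>; so these preimages converge when \<open>B\<^sup>* z\<close> does, which puts \<open>B m\<close> in the
  range of \<open>A\<close> for all \<open>m\<close> in the closure of the range of \<open>B\<^sup>*\<close>. On the complement of that closure \<open>B\<close>
  is zero (\<open>range_subset_of_adjoint_dominated\<close>).

  Monotonicity of the norm (\<open>norm_sq_le_norm_sum\<close>) rests on the theorem of Fukamiya and Kaplansky that
  \<open>s\<^sup>* s\<close> is positive. It is proved here by norm estimates only, without spectra. In a
  unital algebra, positivity of a self-adjoint \<open>p\<close> means \<open>\<parallel>t - p\<parallel> \<le> t\<close> for some \<open>t \<ge> 0\<close>, which makes
  positive elements a cone, and a fixed point argument provides square roots. Algebras without unit
  are embedded in their multiplier algebra.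
\<close>

section \<open>Two tools from Banach space theory\<close>

text \<open>
  The sets where all functions of the family are bounded by \<open>k\<close> are closed and cover the space, so by
  Baire's theorem one of them contains a ball; linearity moves the bound on that ball to the origin.
\<close>
lemma uniform_boundedness:
  fixes F :: "('e::banach \<Rightarrow> 'f::real_normed_vector) set"
  assumes lin: "\<And>f. f \<in> F \<Longrightarrow> bounded_linear f"
    and pointwise: "\<And>x. \<exists>K. \<forall>f\<in>F. norm (f x) \<le> K"
  shows "\<exists>K. \<forall>f\<in>F. \<forall>x. norm (f x) \<le> K * norm x"
proof -
  define C where "C k = {x. \<forall>f\<in>F. norm (f x) \<le> real k}" for k :: nat
  have C_Inter: "C k = (\<Inter>f\<in>F. {x. norm (f x) \<le> real k})" for k
    by (auto simp: C_def)
  have closed_C: "closed (C k)" for k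
    unfolding C_Inter using lin
    by (intro closed_INT ballI closed_Collect_le continuous_on_norm linear_continuous_on
        continuous_on_const) auto
  have "\<Union>(range C) = UNIV"
  proof -
    have "x \<in> \<Union>(range C)" for x
    proof -
      obtain K where K: "\<forall>f\<in>F. norm (f x) \<le> K"
        using pointwise by blast
      obtain k :: nat where "K \<le> real k"
        using real_arch_simple by blast
      then have "x \<in> C k"
        using K by (force simp: C_def)
      then show ?thesis by blast
    qed
    then show ?thesis by blast
  qed
  then have "\<not> (\<forall>k. interior (C k) = {})"
    using Baire_category_alt[of "euclidean :: 'e topology" "range C"] closed_C
      completely_metrizable_space_euclidean by fastforce
  then obtain k x0 where "x0 \<in> interior (C k)"
    by blast
  then obtain e where e: "e > 0" and "cball x0 e \<subseteq> C k"
    by (meson mem_interior_cball)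
  then have bound: "norm (f x) \<le> real k" if "f \<in> F" "dist x0 x \<le> e" for f x
    using that by (auto simp: C_def)
  have "norm (f x) \<le> (2 * real k / e) * norm x" if f: "f \<in> F" for f x
  proof (cases "x = 0")
    case True
    then show ?thesis
      using lin[OF f] by (simp add: linear_simps)
  next
    case False
    interpret f: bounded_linear f by (rule lin[OF f])
    define y where "y = (e / norm x) *\<^sub>R x"
    have y: "norm y = e"
      using False e by (simp add: y_def)
    have "norm (f y) = norm (f (x0 + y) - f x0)"
      by (simp add: f.add)
    also have "\<dots> \<le> real k + real k"
      using bound[OF f, of "x0 + y"] bound[OF f, of x0] y e
      by (intro order.trans[OF norm_triangle_ineq4] add_mono) (auto simp: dist_norm)
    finally have "(e / norm x) * norm (f x) \<le> 2 * real k"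
      using e by (simp add: y_def f.scaleR)
    then show ?thesis
      using False e by (simp add: field_simps)
  qed
  then show ?thesis by blast
qed

text \<open>
  A solution \<open>y\<close> makes \<open>1 - y\<close> a square root of \<open>1 - h\<close>. The map \<open>y \<mapsto> (h + y \<cdot> y) / 2\<close> is a contraction of
  the ball of radius \<open>\<parallel>h\<parallel> < 1\<close>. The closed invariant set \<open>C\<close> is a parameter so that
  self-adjointness and commutation relations can be carried over to \<open>y\<close>. The product is any bounded
  bilinear map of norm at most 1, which covers algebras as well as composition of operators.
\<close>
lemma quadratic_fixpoint:
  fixes h :: "'v::banach"
  assumes mul: "bounded_bilinear mul"
    and contractive: "\<And>x y. norm (mul x y) \<le> norm x * norm y"
    and h: "norm h < 1"
    and C: "closed C" "0 \<in> C" "\<And>y. y \<in> C \<Longrightarrow> (1/2) *\<^sub>R (h + mul y y) \<in> C"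
  obtains y where "y \<in> C" "norm y \<le> norm h" "2 *\<^sub>R y = h + mul y y"
proof -
  interpret bounded_bilinear mul by (rule mul)
  define r where "r = norm h"
  have r: "0 \<le> r" "r < 1"
    using h by (auto simp: r_def)
  define f where "f y = (1/2) *\<^sub>R (h + mul y y)" for y
  have bound: "norm (f y) \<le> r" if "norm y \<le> r" for y
  proof -
    have "norm (mul y y) \<le> r * r"
      using contractive[of y y] that r by (meson mult_mono norm_ge_zero order_trans)
    also have "\<dots> \<le> 1 * r"
      using r by (intro mult_right_mono) auto
    finally have "norm (h + mul y y) \<le> r + r"
      using norm_triangle_ineq[of h "mul y y"] by (simp add: r_def)
    then show ?thesis
      by (simp add: f_def)
  qed
  have "\<exists>!y. y \<in> C \<inter> cball 0 r \<and> f y = y"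
  proof (rule Banach_fix)
    show "complete (C \<inter> cball 0 r)"
      using C(1) by (intro closed_Int closed_cball complete_eq_closed[THEN iffD2])
    show "C \<inter> cball 0 r \<noteq> {}"
      using C(2) r by auto
    show "f ` (C \<inter> cball 0 r) \<subseteq> C \<inter> cball 0 r"
      using C(3) bound by (auto simp: f_def)
  next
    fix x y assume "x \<in> C \<inter> cball 0 r" "y \<in> C \<inter> cball 0 r"
    then have xy: "norm x \<le> r" "norm y \<le> r"
      by auto
    have "f x - f y = (1/2) *\<^sub>R (mul x (x - y) + mul (x - y) y)"
      by (simp add: f_def diff_left diff_right algebra_simps)
    also have "norm \<dots> \<le> (1/2) * (norm x * norm (x - y) + norm (x - y) * norm y)"
      using norm_triangle_ineq[of "mul x (x - y)" "mul (x - y) y"]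
        contractive[of x "x - y"] contractive[of "x - y" y] by simp
    also have "\<dots> \<le> (1/2) * (r * norm (x - y) + norm (x - y) * r)"
      using xy by (intro mult_left_mono add_mono mult_right_mono) auto
    finally show "dist (f x) (f y) \<le> r * dist x y"
      by (simp add: dist_norm)
  qed (use r in auto)
  then obtain y where y: "y \<in> C" "norm y \<le> r" "f y = y"
    by auto
  have "2 *\<^sub>R y = 2 *\<^sub>R f y"
    by (simp add: y(3))
  also have "\<dots> = h + mul y y"
    by (simp add: f_def)
  finally show ?thesis
    using that y r_def by blast
qed

section \<open>Scalars and the involution\<close>

lemma scaleC_one [simp]: "1 *\<^sub>C x = (x::'a::complex_vector)"
  using scaleR_scaleC[of 1 x] by simp

lemma scaleC_zero_right [simp]: "z *\<^sub>C (0::'a::complex_vector) = 0"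
  using scaleC_add_right[of z 0 0] by simp

lemma scaleC_minus_right: "z *\<^sub>C (- x) = - (z *\<^sub>C (x::'a::complex_vector))"
  using scaleC_add_right[of z "-x" x] by (simp add: eq_neg_iff_add_eq_0)

lemma scaleC_diff_right: "z *\<^sub>C (x - y) = z *\<^sub>C x - z *\<^sub>C (y::'a::complex_vector)"
  using scaleC_add_right[of z x "-y"] by (simp add: scaleC_minus_right)

lemma scaleC_minus_one: "(-1) *\<^sub>C x = - (x::'a::complex_vector)"
  using scaleR_scaleC[of "-1" x] by simp

lemma scaleC_minus_left: "(- z) *\<^sub>C x = - (z *\<^sub>C (x::'a::complex_vector))"
  using scaleC_scaleC[of "-1" z x] by (simp add: scaleC_minus_one)

lemma star_scaleR: "star (r *\<^sub>R x) = r *\<^sub>R star (x::'a::cstar_algebra)"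
  by (simp add: scaleR_scaleC star_scaleC)

lemma star_zero [simp]: "star (0::'a::cstar_algebra) = 0"
  using star_scaleR[of 0] by simp

lemma star_minus: "star (- x) = - star (x::'a::cstar_algebra)"
  using star_scaleR[of "-1" x] by simp

lemma star_diff: "star (x - y) = star x - star (y::'a::cstar_algebra)"
  using star_add[of x "-y"] by (simp add: star_minus)

lemma norm_star: "norm (star x) = norm (x::'a::cstar_algebra)"
proof -
  have le: "norm y \<le> norm (star y)" for y :: 'a
  proof (cases "norm y = 0")
    case False
    have "(norm y)\<^sup>2 \<le> norm (star y) * norm y"
      using norm_mult_ineq[of "star y" y] by (simp add: cstar_identity)
    then show ?thesis
      using False by (simp add: power2_eq_square)
  qed auto
  show ?thesis
    using le[of x] le[of "star x"] by (simp add: star_star)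
qed

lemma bounded_linear_star: "bounded_linear (star :: 'a::cstar_algebra \<Rightarrow> 'a)"
  by (rule bounded_linear_intro[where K = 1]) (auto simp: star_add star_scaleR norm_star)

section \<open>Positive elements of a unital $C^*$-algebra\<close>

text \<open>
  Asking for \<^class>\<open>monoid_mult\<close> instead of \<^class>\<open>ring_1\<close> admits the zero algebra, which is the
  multiplier algebra of the zero algebra. Real numbers are therefore written as multiples
  \<open>r *\<^sub>R 1\<close>, and the norm of \<open>1\<close> is only known to be at most 1.
\<close>
class unital_cstar_algebra = cstar_algebra + monoid_mult

lemma star_one [simp]: "star (1::'a::unital_cstar_algebra) = 1"
  by (metis mult_1_left mult_1_right star_mult star_star)

lemma norm_one_le: "norm (1::'a::unital_cstar_algebra) \<le> 1"
proof (rule ccontr)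
  assume "\<not> ?thesis"
  then have "norm (1::'a) < (norm (1::'a))\<^sup>2"
    unfolding power2_eq_square by (intro mult_less_cancel_left1[THEN iffD2]) auto
  then show False
    using cstar_identity[of "1::'a"] by simp
qed

lemma norm_scaleR_one_le: "0 \<le> r \<Longrightarrow> norm (r *\<^sub>R (1::'a::unital_cstar_algebra)) \<le> r"
  using mult_left_mono[OF norm_one_le[where 'a='a], of r] by simp

lemma norm_square_selfadjoint:
  "star x = x \<Longrightarrow> norm (x * x) = (norm (x::'a::cstar_algebra))\<^sup>2"
  using cstar_identity[of x] by simp

text \<open>
  If \<open>q\<^sup>2 + r\<^sup>2 = m\<close> then \<open>u = q + \<i> r\<close> is \<open>\<surd>m\<close> times a unitary element, and \<open>q\<^sup>2 - r\<^sup>2\<close> is the real part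
  of \<open>u\<^sup>2\<close>. This identity replaces the spectral theorem in what follows.
\<close>
lemma norm_diff_squares_le:
  fixes q r :: "'a::unital_cstar_algebra"
  assumes sa: "star q = q" "star r = r" and comm: "q * r = r * q"
    and sum: "q * q + r * r = m *\<^sub>R 1" and m: "0 \<le> m"
  shows "norm (q * q - r * r) \<le> m"
proof -
  define u where "u = q + \<i> *\<^sub>C r"
  have star_u: "star u = q - \<i> *\<^sub>C r"
    by (simp add: u_def sa star_add star_scaleC scaleC_minus_left)
  have "star u * u = q * q + r * r"
    by (simp add: star_u) (simp add: u_def comm algebra_simps mult_scaleC_left mult_scaleC_right
        scaleC_scaleC scaleC_minus_one scaleC_diff_right)
  then have "(norm u)\<^sup>2 \<le> m"
    using norm_scaleR_one_le[OF m, where 'a='a] by (simp add: sum flip: cstar_identity)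
  moreover have "u * u + star u * star u = 2 *\<^sub>R (q * q - r * r)"
    by (simp add: star_u) (simp add: u_def comm algebra_simps mult_scaleC_left mult_scaleC_right
        scaleC_scaleC scaleC_minus_one scaleC_diff_right scaleC_add_right scaleR_2)
  then have "2 * norm (q * q - r * r) = norm (u * u + star u * star u)"
    by simp
  moreover have "norm (u * u + star u * star u) \<le> norm u * norm u + norm (star u) * norm (star u)"
    by (intro order.trans[OF norm_triangle_ineq] add_mono norm_mult_ineq)
  ultimately show ?thesis
    by (simp add: norm_star power2_eq_square)
qed

lemma sqrt_one_minus:
  fixes h :: "'a::unital_cstar_algebra"
  assumes "star h = h" and "norm h < 1"
  obtains q where "star q = q" "q * q = 1 - h" "\<And>z. z * h = h * z \<Longrightarrow> z * q = q * z"
proof -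
  define C where "C = {y::'a. star y = y} \<inter> (\<Inter>z\<in>{z. z * h = h * z}. {y. z * y = y * z})"
  have C_D: "star y = y" "z * h = h * z \<Longrightarrow> z * y = y * z" if "y \<in> C" for y z
    using that unfolding C_def by blast+
  have "closed C"
    unfolding C_def
    by (intro closed_Int closed_INT ballI closed_Collect_eq continuous_on_mult continuous_on_id
        continuous_on_const linear_continuous_on bounded_linear_star)
  moreover have "(1/2) *\<^sub>R (h + y * y) \<in> C" if "y \<in> C" for y
  proof -
    have commute: "z * (y * y) = y * y * z" if "z * y = y * z" for z
    proof -
      have "z * (y * y) = (z * y) * y"
        by (rule mult.assoc[symmetric])
      also have "\<dots> = y * (z * y)"
        by (simp only: that mult.assoc)
      also have "\<dots> = y * y * z"
        by (simp only: that mult.assoc)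
      finally show ?thesis .
    qed
    show ?thesis
      unfolding C_def
    proof (intro IntI INT_I CollectI)
      show "star ((1/2) *\<^sub>R (h + y * y)) = (1/2) *\<^sub>R (h + y * y)"
        using C_D(1)[OF that] assms(1) by (simp add: star_scaleR star_add star_mult)
      fix z assume "z \<in> {z. z * h = h * z}"
      then have zh: "z * h = h * z"
        by blast
      show "z * ((1/2) *\<^sub>R (h + y * y)) = (1/2) *\<^sub>R (h + y * y) * z"
        by (simp add: distrib_left distrib_right zh commute[OF C_D(2)[OF \<open>y \<in> C\<close> zh]])
    qed
  qed
  moreover have "0 \<in> C"
    by (simp add: C_def)
  ultimately obtain y where y: "y \<in> C" "2 *\<^sub>R y = h + y * y"
    using quadratic_fixpoint[OF bounded_bilinear_mult norm_mult_ineq assms(2), of C] by metis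
  show ?thesis
  proof (rule that[of "1 - y"])
    show "star (1 - y) = 1 - y"
      by (simp add: C_D(1)[OF y(1)] star_diff)
    have "(1 - y) * (1 - y) = 1 - 2 *\<^sub>R y + y * y"
      by (simp add: algebra_simps scaleR_2)
    then show "(1 - y) * (1 - y) = 1 - h"
      by (simp add: y(2))
    show "z * (1 - y) = (1 - y) * z" if "z * h = h * z" for z
      by (simp add: C_D(2)[OF y(1) that] right_diff_distrib left_diff_distrib)
  qed
qed

text \<open>
  For self-adjoint \<open>p\<close> the inequality says that the spectrum of \<open>p\<close> lies in \<open>[0, 2 t]\<close>. In this
  form positive elements are visibly closed under addition.
\<close>
definition psd :: "'a::unital_cstar_algebra \<Rightarrow> bool" where
  "psd p \<longleftrightarrow> star p = p \<and> (\<exists>t\<ge>0. norm (t *\<^sub>R 1 - p) \<le> t)"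

lemma psd_selfadjoint: "psd p \<Longrightarrow> star p = p"
  by (simp add: psd_def)

lemma psd_add:
  assumes "psd p" "psd q"
  shows "psd (p + q)"
proof -
  obtain t u where tu: "t \<ge> 0" "norm (t *\<^sub>R 1 - p) \<le> t" "u \<ge> 0" "norm (u *\<^sub>R 1 - q) \<le> u"
    using assms by (auto simp: psd_def)
  have "norm ((t + u) *\<^sub>R 1 - (p + q)) = norm ((t *\<^sub>R 1 - p) + (u *\<^sub>R 1 - q))"
    by (simp add: algebra_simps)
  also have "\<dots> \<le> t + u"
    using tu by (intro norm_triangle_le) auto
  finally have "norm ((t + u) *\<^sub>R 1 - (p + q)) \<le> t + u" .
  then show ?thesis
    using assms tu(1,3) unfolding psd_def by (auto simp: star_add intro!: exI[of _ "t + u"])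
qed

lemma psd_scaleR_one: "0 \<le> r \<Longrightarrow> psd (r *\<^sub>R 1)"
  by (auto simp: psd_def star_scaleR intro!: exI[of _ r])

lemma psd_scaleR:
  assumes "0 \<le> r" "psd p"
  shows "psd (r *\<^sub>R p)"
proof -
  obtain t where t: "t \<ge> 0" "norm (t *\<^sub>R 1 - p) \<le> t"
    using assms by (auto simp: psd_def)
  have "norm ((r * t) *\<^sub>R 1 - r *\<^sub>R p) = r * norm (t *\<^sub>R 1 - p)"
    using assms(1) by (simp flip: scaleR_diff_right scaleR_scaleR)
  also have "\<dots> \<le> r * t"
    using t assms(1) by (intro mult_left_mono)
  finally show ?thesis
    using assms t(1) unfolding psd_def by (auto simp: star_scaleR intro!: exI[of _ "r * t"])
qed

lemma psd_norm_minus: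
  assumes "star x = x" "norm x \<le> t"
  shows "psd (t *\<^sub>R 1 - x)"
  using assms norm_ge_zero[of x] unfolding psd_def
  by (auto simp: star_diff star_scaleR intro!: exI[of _ t] simp del: norm_ge_zero)

text \<open>
  The shift by \<open>e\<close> brings the norm of \<open>(t - p) / (t + e)\<close> strictly below 1, as the
  fixed point construction requires; it is removed afterwards by letting \<open>e\<close> tend to 0.
\<close>
lemma sqrt_of_shifted_psd:
  fixes p :: "'a::unital_cstar_algebra"
  assumes "psd p" "0 < e"
  obtains q where "star q = q" "q * q = p + e *\<^sub>R 1" "\<And>z. z * p = p * z \<Longrightarrow> z * q = q * z"
proof -
  obtain t where t: "t \<ge> 0" "norm (t *\<^sub>R 1 - p) \<le> t"
    using assms by (auto simp: psd_def)
  define h where "h = (1 / (t + e)) *\<^sub>R (t *\<^sub>R 1 - p)"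
  have "star h = h"
    using psd_selfadjoint[OF assms(1)] by (simp add: h_def star_scaleR star_diff)
  moreover have "norm h < 1"
    using t assms(2) by (simp add: h_def)
  ultimately obtain q where q: "star q = q" "q * q = 1 - h" "\<And>z. z * h = h * z \<Longrightarrow> z * q = q * z"
    using sqrt_one_minus by blast
  show ?thesis
  proof (rule that[of "sqrt (t + e) *\<^sub>R q"])
    show "star (sqrt (t + e) *\<^sub>R q) = sqrt (t + e) *\<^sub>R q"
      by (simp add: star_scaleR q(1))
    have "(sqrt (t + e) *\<^sub>R q) * (sqrt (t + e) *\<^sub>R q) = (t + e) *\<^sub>R (1 - h)"
      using t assms(2) by (simp add: q(2))
    also have "\<dots> = p + e *\<^sub>R 1"
      using t assms(2) by (simp add: h_def scaleR_diff_right scaleR_add_left)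
    finally show "(sqrt (t + e) *\<^sub>R q) * (sqrt (t + e) *\<^sub>R q) = p + e *\<^sub>R 1" .
    show "z * (sqrt (t + e) *\<^sub>R q) = (sqrt (t + e) *\<^sub>R q) * z" if "z * p = p * z" for z
    proof -
      have "z * h = h * z"
        using that by (simp add: h_def algebra_simps)
      then show ?thesis
        using q(3) by simp
    qed
  qed
qed

text \<open>
  Approximate square roots \<open>q\<close> and \<open>r\<close> of \<open>a + k\<close> and \<open>a - k\<close> commute, and the sum of their squares is
  scalar, so \<open>norm_diff_squares_le\<close> bounds their difference \<open>2 k\<close>.
\<close>
lemma norm_le_of_psd_bounds:
  fixes k :: "'a::unital_cstar_algebra"
  assumes psd: "psd (a *\<^sub>R 1 + k)" "psd (a *\<^sub>R 1 - k)" and a: "0 \<le> a"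
  shows "norm k \<le> a"
proof (rule field_le_epsilon)
  fix e :: real assume e: "0 < e"
  obtain q where q: "star q = q" "q * q = a *\<^sub>R 1 + k + e *\<^sub>R 1"
    "\<And>z. z * (a *\<^sub>R 1 + k) = (a *\<^sub>R 1 + k) * z \<Longrightarrow> z * q = q * z"
    by (rule sqrt_of_shifted_psd[OF psd(1) e, of thesis]) (rule that)
  obtain r where r: "star r = r" "r * r = a *\<^sub>R 1 - k + e *\<^sub>R 1"
    "\<And>z. z * (a *\<^sub>R 1 - k) = (a *\<^sub>R 1 - k) * z \<Longrightarrow> z * r = r * z"
    by (rule sqrt_of_shifted_psd[OF psd(2) e, of thesis]) (rule that)
  have "k * q = q * k"
    by (rule q(3)) (simp add: algebra_simps)
  then have "q * r = r * q"
    by (intro r(3)) (simp add: algebra_simps)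
  moreover have "q * q + r * r = (2 * (a + e)) *\<^sub>R 1"
    by (simp add: q(2) r(2) scaleR_2 scaleR_add_left flip: scaleR_scaleR)
  ultimately have "norm (q * q - r * r) \<le> 2 * (a + e)"
    using a e by (intro norm_diff_squares_le q(1) r(1)) auto
  moreover have "q * q - r * r = 2 *\<^sub>R k"
    by (simp add: q(2) r(2) scaleR_2)
  ultimately show "norm k \<le> a + e"
    by simp
qed

lemma norm_le_of_psd:
  assumes "psd p" "psd (a *\<^sub>R 1 - p)" "0 \<le> a"
  shows "norm p \<le> a"
  using assms by (intro norm_le_of_psd_bounds psd_add psd_scaleR_one)

text \<open>
  The parameter \<open>t\<close> may always be taken to be the norm, which turns positivity into a closed condition.
\<close>
lemma psd_iff_norm:
  "psd p \<longleftrightarrow> star p = p \<and> norm (norm p *\<^sub>R 1 - p) \<le> norm p"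
proof
  assume p: "psd p"
  have "psd (norm p *\<^sub>R 1 + (norm p *\<^sub>R 1 - p))"
    using p by (intro psd_add psd_scaleR_one psd_norm_minus) (auto simp: psd_def)
  moreover have "psd (norm p *\<^sub>R 1 - (norm p *\<^sub>R 1 - p))"
    using p by simp
  ultimately show "star p = p \<and> norm (norm p *\<^sub>R 1 - p) \<le> norm p"
    using p by (auto intro: norm_le_of_psd_bounds psd_selfadjoint)
qed (auto simp: psd_def intro!: exI[of _ "norm p"])

lemma closed_psd: "closed {p. psd p}"
  unfolding psd_iff_norm
  by (intro closed_Collect_conj closed_Collect_eq closed_Collect_le continuous_intros
      linear_continuous_on bounded_linear_star)

text \<open>
  With \<open>R\<close> a square root of \<open>t - q\<^sup>2\<close>, the element \<open>t - q\<^sup>2\<close> is the mean of \<open>t\<close> and \<open>R\<^sup>2 - q\<^sup>2\<close>, and both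
  have norm at most \<open>t\<close>.
\<close>
lemma psd_square:
  fixes q :: "'a::unital_cstar_algebra"
  assumes sa: "star q = q"
  shows "psd (q * q)"
proof -
  define t where "t = (norm q)\<^sup>2 + 1"
  have t: "t > 0"
    unfolding t_def by (rule add_nonneg_pos) auto
  define h where "h = (1 / t) *\<^sub>R (q * q)"
  have "star h = h"
    by (simp add: h_def star_scaleR star_mult sa)
  moreover have "norm h < 1"
    using t by (simp add: h_def norm_square_selfadjoint sa) (simp add: t_def)
  ultimately obtain r where r: "star r = r" "r * r = 1 - h" "\<And>z. z * h = h * z \<Longrightarrow> z * r = r * z"
    by (rule sqrt_one_minus[of h thesis]) (rule that)
  define R where "R = sqrt t *\<^sub>R r"
  have RR: "R * R = t *\<^sub>R 1 - q * q"
    using t by (simp add: R_def r(2) h_def algebra_simps)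
  have "q * r = r * q"
    by (rule r(3)) (simp add: h_def mult.assoc)
  then have "norm (q * q - R * R) \<le> t"
    using t by (intro norm_diff_squares_le) (auto simp: sa RR, auto simp: R_def r(1) star_scaleR)
  moreover have "t *\<^sub>R 1 - q * q = (1/2) *\<^sub>R (t *\<^sub>R 1 - (q * q - R * R))"
    by (simp add: RR scaleR_2 scaleR_diff_right) (simp add: algebra_simps flip: scaleR_add_left)
  moreover have "norm (t *\<^sub>R 1 - (q * q - R * R)) \<le> norm (t *\<^sub>R (1::'a)) + norm (q * q - R * R)"
    by (rule norm_triangle_ineq4)
  moreover have "norm (t *\<^sub>R (1::'a)) \<le> t"
    using t by (intro norm_scaleR_one_le) simp
  ultimately have "norm (t *\<^sub>R 1 - q * q) \<le> t"
    by (simp del: norm_scaleR) (simp only: norm_scaleR)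
  then show ?thesis
    using t sa by (auto simp: psd_def star_mult intro!: exI[of _ t])
qed

text \<open>
  After a shift by \<open>e\<close> both factors have square roots, which commute; the product is then the square
  of a self-adjoint element, and \<open>e\<close> tends to 0 in the closed set of positive elements.
\<close>
lemma psd_mult:
  fixes p p' :: "'a::unital_cstar_algebra"
  assumes psd: "psd p" "psd p'" and comm: "p * p' = p' * p"
  shows "psd (p * p')"
proof -
  have shifted: "psd ((p + e *\<^sub>R 1) * (p' + e *\<^sub>R 1))" if e: "0 < e" for e
  proof -
    obtain q where q: "star q = q" "q * q = p + e *\<^sub>R 1" "\<And>z. z * p = p * z \<Longrightarrow> z * q = q * z"
      by (rule sqrt_of_shifted_psd[OF psd(1) e, of thesis]) (rule that)
    obtain r where r: "star r = r" "r * r = p' + e *\<^sub>R 1" "\<And>z. z * p' = p' * z \<Longrightarrow> z * r = r * z"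
      by (rule sqrt_of_shifted_psd[OF psd(2) e, of thesis]) (rule that)
    have "p' * q = q * p'"
      by (rule q(3)) (rule comm[symmetric])
    then have qr: "q * r = r * q"
      by (intro r(3)) simp
    then have "(p + e *\<^sub>R 1) * (p' + e *\<^sub>R 1) = (q * r) * (q * r)"
      by (metis mult.assoc q(2) r(2))
    moreover have "star (q * r) = q * r"
      by (simp add: star_mult q(1) r(1) qr)
    ultimately show ?thesis
      by (simp add: psd_square)
  qed
  have "((\<lambda>e. (p + e *\<^sub>R 1) * (p' + e *\<^sub>R 1)) \<longlongrightarrow> (p + 0 *\<^sub>R 1) * (p' + 0 *\<^sub>R 1)) (at_right 0)"
    by (intro tendsto_intros)
  moreover have "\<forall>\<^sub>F e in at_right 0. (p + e *\<^sub>R 1) * (p' + e *\<^sub>R 1) \<in> {p. psd p}"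
    using shifted by (auto simp: eventually_at_filter intro!: always_eventually)
  ultimately have "(p + 0 *\<^sub>R 1) * (p' + 0 *\<^sub>R 1) \<in> {p. psd p}"
    by (rule Lim_in_closed_set[OF closed_psd, rotated 2]) simp
  then show ?thesis
    by simp
qed

section \<open>Elements of the form $s^*s$ are positive\<close>

text \<open>
  An upper bound for \<open>c\<^sup>* c\<close> alone bounds its norm, although \<open>c\<^sup>* c\<close> is not yet known to be positive.
  The reason is that \<open>k = c\<^sup>* c\<close> and \<open>k' = c c\<^sup>*\<close> have positive sum, so \<open>k \<le> a\<close> forces \<open>k' \<ge> -a\<close>. Suppose
  that \<open>N = \<parallel>k\<parallel>\<close> exceeds \<open>a\<close>. Then the norm is attained on the negative side, so \<open>w = N - k\<close> has norm at
  least \<open>2 N\<close>, while \<open>v = N - k'\<close> has norm at most \<open>N + a < 2 N\<close>. The intertwining \<open>k w = c\<^sup>* v c\<close> transfers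
  the second bound to \<open>k w\<close> and contradicts the first.
\<close>
lemma norm_sq_le_of_psd:
  fixes c :: "'a::unital_cstar_algebra"
  assumes upper: "psd (a *\<^sub>R 1 - star c * c)" and a: "0 \<le> a"
  shows "(norm c)\<^sup>2 \<le> a"
proof (rule ccontr)
  define N where "N = (norm c)\<^sup>2"
  define k where "k = star c * c"
  define k' where "k' = c * star c"
  assume "\<not> ?thesis"
  then have aN: "a < N"
    by (simp add: N_def)
  have sa: "star k = k" "star k' = k'"
    by (simp_all add: k_def k'_def star_mult star_star)
  have norm_k: "norm k = N" "norm k' = N"
    using cstar_identity[of c] cstar_identity[of "star c"]
    by (simp_all add: k_def k'_def N_def star_star norm_star)
  have "psd (k + k')"
  proof -
    \<comment> \<open>Up to sign, twice the real and imaginary parts of \<open>c\<close>: the cross terms cancel in the sum of their squares.\<close>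
    define x where "x = c + star c"
    define y where "y = \<i> *\<^sub>C (c - star c)"
    have "star x = x" "star y = y"
      by (simp_all add: x_def y_def star_add star_diff star_star star_scaleC add.commute
          scaleC_minus_left scaleC_diff_right)
    moreover have "x * x + y * y = 2 *\<^sub>R (k + k')"
      by (simp add: x_def y_def k_def k'_def mult_scaleC_left mult_scaleC_right scaleC_scaleC
          scaleC_minus_one scaleC_diff_right algebra_simps scaleR_2)
    ultimately have "psd (2 *\<^sub>R (k + k'))"
      by (metis psd_add psd_square)
    then show ?thesis
      using psd_scaleR[of "1/2" "2 *\<^sub>R (k + k')"] by simp
  qed
  then have "psd ((a *\<^sub>R 1 - k) + (k + k'))"
    by (rule psd_add[OF upper[folded k_def]])
  then have lower: "psd (a *\<^sub>R 1 + k')"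
    by simp
  define w where "w = N *\<^sub>R 1 - k"
  define v where "v = N *\<^sub>R 1 - k'"
  have "norm v \<le> N + a"
  proof (rule norm_le_of_psd)
    show "psd v"
      unfolding v_def by (rule psd_norm_minus) (simp_all add: sa norm_k)
    show "psd ((N + a) *\<^sub>R 1 - v)"
      using lower by (simp add: v_def scaleR_add_left)
  qed (use a aN in simp)
  define M where "M = norm w"
  have sa_w: "star w = w"
    by (simp add: w_def star_diff star_scaleR sa)
  have M: "2 * N \<le> M"
  proof (rule ccontr)
    assume "\<not> 2 * N \<le> M"
    define b where "b = max a (M - N)"
    have b: "a \<le> b" "M - N \<le> b" "b < N"
      using \<open>\<not> 2 * N \<le> M\<close> aN by (auto simp: b_def)
    have "psd ((b - a) *\<^sub>R 1 + (a *\<^sub>R 1 - k))"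
      using upper b(1) by (intro psd_add psd_scaleR_one) (simp_all add: k_def)
    then have "psd (b *\<^sub>R 1 - k)"
      by (simp add: scaleR_diff_left)
    moreover have "psd ((b - (M - N)) *\<^sub>R 1 + (M *\<^sub>R 1 - w))"
      using b(2) by (intro psd_add psd_scaleR_one psd_norm_minus sa_w) (simp_all add: M_def)
    then have "psd (b *\<^sub>R 1 + k)"
      by (simp add: scaleR_diff_left w_def)
    ultimately have "norm k \<le> b"
      using a b(1) by (intro norm_le_of_psd_bounds) auto
    then show False
      using b(3) norm_k by simp
  qed
  \<comment> \<open>This is \<open>w\<^sup>2 = N w - k w\<close> with \<open>k w = c\<^sup>* v c\<close>.\<close>
  have ww: "w * w = N *\<^sub>R w - star c * (v * c)"
    by (simp add: w_def v_def k_def k'_def algebra_simps)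
  have "norm (star c * (v * c)) \<le> norm (star c) * (norm v * norm c)"
    by (intro order.trans[OF norm_mult_ineq] mult_left_mono) auto
  moreover have "norm (star c) * (norm v * norm c) \<le> N * (N + a)"
    using mult_left_mono[OF \<open>norm v \<le> N + a\<close>, of N]
    by (simp add: N_def norm_star power2_eq_square mult_ac)
  moreover have "norm (N *\<^sub>R w - star c * (v * c)) = M * M"
    by (simp add: norm_square_selfadjoint sa_w M_def power2_eq_square flip: ww)
  moreover have "norm (N *\<^sub>R w - star c * (v * c)) \<le> N * M + norm (star c * (v * c))"
    using norm_triangle_ineq4[of "N *\<^sub>R w" "star c * (v * c)"] aN a by (simp add: M_def)
  ultimately have "M * (M - N) \<le> N * (N + a)"
    by (simp add: algebra_simps)
  moreover have "(2 * N) * N \<le> M * (M - N)"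
    using M aN a by (intro mult_mono) auto
  moreover have "N * (N + a) < N * (2 * N)"
    using aN a by (intro mult_strict_left_mono) auto
  ultimately show False
    by (simp add: mult_ac)
qed

lemma norm_power_le:
  fixes x :: "'a::unital_cstar_algebra"
  shows "norm (x ^ n) \<le> norm x ^ n"
proof (induction n)
  case 0
  show ?case by (simp add: norm_one_le)
next
  case (Suc n)
  then show ?case
    using norm_mult_ineq[of x "x ^ n"] mult_left_mono[OF Suc norm_ge_zero[of x]] by simp
qed

lemma star_power:
  fixes x :: "'a::unital_cstar_algebra"
  shows "star (x ^ n) = star x ^ n"
  by (induction n) (simp_all add: star_mult power_commutes)

text \<open>
  By the \<open>C\<^sup>*\<close>-identity the square of \<open>\<parallel>x\<^sup>n\<parallel>\<close> is \<open>\<parallel>x\<^sup>2\<^sup>n\<parallel>\<close>, at most \<open>\<parallel>x\<^sup>n\<^sup>-\<^sup>1\<parallel> \<parallel>x\<^sup>n\<^sup>+\<^sup>1\<parallel>\<close>, so equality with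
  \<open>\<parallel>x\<parallel>\<^sup>n\<close> passes from one exponent to the next. The exponent 0 is excluded
  because of the zero algebra.
\<close>
lemma norm_power_Suc_selfadjoint:
  fixes x :: "'a::unital_cstar_algebra"
  assumes sa: "star x = x"
  shows "norm x ^ Suc n \<le> norm (x ^ Suc n)"
proof (induction n)
  case (Suc n)
  show ?case
  proof (cases "x = 0")
    case False
    have "norm x ^ Suc n * norm x ^ Suc n \<le> norm (x ^ Suc n) * norm (x ^ Suc n)"
      by (intro mult_mono Suc) auto
    also have "\<dots> = norm (x ^ Suc n * x ^ Suc n)"
      using norm_square_selfadjoint[of "x ^ Suc n"] by (simp only: star_power sa power2_eq_square)
    also have "x ^ Suc n * x ^ Suc n = x ^ n * x ^ Suc (Suc n)"
      by (simp only: flip: power_add) simp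
    also have "norm \<dots> \<le> norm x ^ n * norm (x ^ Suc (Suc n))"
      by (intro order.trans[OF norm_mult_ineq] mult_right_mono norm_power_le) auto
    finally have "norm x ^ n * norm x ^ Suc (Suc n) \<le> norm x ^ n * norm (x ^ Suc (Suc n))"
      by (simp add: mult_ac)
    then show ?thesis
      by (rule mult_left_le_imp_le) (simp add: False)
  qed auto
qed auto

lemma psd_power:
  assumes "psd w"
  shows "psd (w ^ n)"
proof (induction n)
  case 0
  show ?case using psd_scaleR_one[of 1] by simp
next
  case (Suc n)
  then show ?case
    using assms by (simp add: psd_mult power_commutes)
qed

text \<open>
  The increment from \<open>n\<close> to \<open>n + 1\<close> is \<open>w\<^sup>n (w - 1)\<^sup>2\<close>. The lemma gives \<open>h (1 - h)\<^sup>n \<le> 1\<close> for \<open>h = 1 - w\<close>,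
  whatever \<open>n\<close> is.
\<close>
lemma psd_one_minus_power_plus_power:
  assumes "psd w"
  shows "psd (1 - w ^ n + w ^ Suc n)"
proof (induction n)
  case 0
  show ?case using assms by simp
next
  case (Suc n)
  have sa: "star (w - 1) = w - 1"
    using assms by (simp add: star_diff psd_selfadjoint)
  have "w ^ n * (w - 1) = (w - 1) * w ^ n"
    by (simp add: algebra_simps power_commutes)
  then have "w ^ n * ((w - 1) * (w - 1)) = (w - 1) * (w - 1) * w ^ n"
    by (metis mult.assoc)
  then have "psd (w ^ n * ((w - 1) * (w - 1)))"
    by (intro psd_mult psd_power assms psd_square sa)
  moreover have "1 - w ^ Suc n + w ^ Suc (Suc n) = (1 - w ^ n + w ^ Suc n) + w ^ n * ((w - 1) * (w - 1))"
    by (simp add: power_Suc2 algebra_simps del: power_Suc)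
  ultimately show ?case
    using Suc by (metis psd_add)
qed

text \<open>
  Let \<open>h = s\<^sup>* s\<close> and suppose that \<open>h\<close> has a negative part; then \<open>\<rho> = \<parallel>1 - h\<parallel>\<close> is larger than 1. For
  \<open>c = s (1 - h)\<^sup>m\<close> the element \<open>c\<^sup>* c = h (1 - h)\<^sup>2\<^sup>m\<close> is bounded above by 1 independently of \<open>m\<close>, hence
  bounded in norm by \<open>norm_sq_le_of_psd\<close>. But the power magnifies the negative part of \<open>h\<close>, and
  the norm of \<open>c\<^sup>* c\<close> is at least \<open>(\<rho> - 1) \<rho>\<^sup>2\<^sup>m\<close>.
\<close>
lemma psd_star_mult_self_norm_one:
  fixes s :: "'a::unital_cstar_algebra"
  assumes s: "norm s = 1"
  shows "psd (star s * s)"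
proof (rule ccontr)
  define h where "h = star s * s"
  define w where "w = 1 - h"
  assume "\<not> ?thesis"
  have "star h = h" "norm h = 1"
    using s by (simp_all add: h_def star_mult star_star cstar_identity)
  then have psd_w: "psd w"
    using psd_norm_minus[of h 1] by (simp add: w_def)
  define \<rho> where "\<rho> = norm w"
  have "\<not> norm (1 *\<^sub>R 1 - h) \<le> 1"
    using \<open>\<not> psd (star s * s)\<close> \<open>star h = h\<close> zero_le_one unfolding psd_def h_def by blast
  then have "\<rho> > 1"
    by (simp add: w_def \<rho>_def)
  then obtain m where m: "1 / (\<rho> - 1) < \<rho> ^ m"
    using real_arch_pow by blast
  define n where "n = m + m"
  have star_w: "star (w ^ m) = w ^ m"
    by (simp add: star_power psd_selfadjoint psd_w)
  define c where "c = s * w ^ m"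
  have "star c * c = w ^ m * (h * w ^ m)"
    by (simp add: c_def star_mult star_w h_def mult.assoc)
  also have "\<dots> = w ^ m * w ^ m - w ^ m * (w * w ^ m)"
    by (simp add: w_def algebra_simps)
  also have "\<dots> = w ^ n - w ^ Suc n"
    by (simp add: n_def power_add power_commutes flip: mult.assoc)
  finally have cc: "star c * c = w ^ n - w ^ Suc n" .
  have "psd (1 *\<^sub>R 1 - star c * c)"
    using psd_one_minus_power_plus_power[OF psd_w, of n] by (simp add: cc algebra_simps)
  then have "(norm c)\<^sup>2 \<le> 1"
    by (rule norm_sq_le_of_psd) simp
  then have "norm (w ^ n - w ^ Suc n) \<le> 1"
    by (simp add: cc flip: cstar_identity)
  moreover have "norm (w ^ Suc n) - norm (w ^ n) \<le> norm (w ^ n - w ^ Suc n)"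
    using norm_triangle_ineq2[of "w ^ Suc n" "w ^ n"] by (simp add: norm_minus_commute)
  ultimately have "\<rho> ^ Suc n - \<rho> ^ n \<le> 1"
    using norm_power_le[of w n] norm_power_Suc_selfadjoint[OF psd_selfadjoint[OF psd_w], of n]
    by (simp add: \<rho>_def)
  then have "\<rho> ^ n * (\<rho> - 1) \<le> 1"
    by (simp add: algebra_simps)
  moreover have "\<rho> ^ m \<le> \<rho> ^ n"
    using \<open>\<rho> > 1\<close> by (intro power_increasing) (auto simp: n_def)
  then have "\<rho> ^ m * (\<rho> - 1) \<le> \<rho> ^ n * (\<rho> - 1)"
    using \<open>\<rho> > 1\<close> by (intro mult_right_mono) auto
  ultimately show False
    using m \<open>\<rho> > 1\<close> by (simp add: field_simps)
qed

lemma psd_star_mult_self: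
  fixes s :: "'a::unital_cstar_algebra"
  shows "psd (star s * s)"
proof (cases "s = 0")
  case True
  then show ?thesis using psd_scaleR_one[of 0] by simp
next
  case False
  define s' where "s' = (1 / norm s) *\<^sub>R s"
  have "psd (star s' * s')"
    using False by (intro psd_star_mult_self_norm_one) (simp add: s'_def)
  then have "psd ((norm s)\<^sup>2 *\<^sub>R (star s' * s'))"
    by (intro psd_scaleR) auto
  then show ?thesis
    using False by (simp add: s'_def star_scaleR power2_eq_square)
qed

text \<open>
  With \<open>h = b\<^sup>* b + s\<^sup>* s\<close>, both \<open>\<parallel>h\<parallel> - h\<close> and \<open>s\<^sup>* s\<close> are positive, and their sum is \<open>\<parallel>h\<parallel> - b\<^sup>* b\<close>.
\<close>
lemma norm_sq_le_norm_sum_unital: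
  fixes b s :: "'a::unital_cstar_algebra"
  shows "(norm b)\<^sup>2 \<le> norm (star b * b + star s * s)"
proof (rule norm_sq_le_of_psd)
  define h where "h = star b * b + star s * s"
  have "psd (norm h *\<^sub>R 1 - h)"
    by (rule psd_norm_minus) (simp_all add: h_def star_add star_mult star_star)
  then have "psd ((norm h *\<^sub>R 1 - h) + star s * s)"
    by (intro psd_add psd_star_mult_self)
  then show "psd (norm (star b * b + star s * s) *\<^sub>R 1 - star b * b)"
    by (simp add: h_def)
qed auto

section \<open>The multiplier algebra\<close>

lemma bounded_linear_scaleC: "bounded_linear (\<lambda>x::'a::complex_normed_vector. z *\<^sub>C x)"
  by (rule bounded_linear_intro[where K = "cmod z"])
    (simp_all add: scaleC_add_right scaleR_scaleC scaleC_scaleC norm_scaleC mult.commute)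

lift_definition scaleC_blinfun ::
    "complex \<Rightarrow> ('b::real_normed_vector \<Rightarrow>\<^sub>L 'a::complex_normed_vector) \<Rightarrow> 'b \<Rightarrow>\<^sub>L 'a"
  is "\<lambda>z f x. z *\<^sub>C f x"
  by (rule bounded_linear_compose[OF bounded_linear_scaleC])

lemma norm_scaleC_blinfun: "norm (scaleC_blinfun z f) = cmod z * norm f"
  for f :: "'b::real_normed_vector \<Rightarrow>\<^sub>L 'a::complex_normed_vector"
proof -
  have le: "norm (scaleC_blinfun z f) \<le> cmod z * norm f" for z and f :: "'b \<Rightarrow>\<^sub>L 'a"
    by (rule norm_blinfun_bound)
      (simp_all add: scaleC_blinfun.rep_eq norm_scaleC mult.assoc mult_left_mono norm_blinfun)
  show ?thesis
  proof (cases "z = 0")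
    case True
    then show ?thesis using le[of z f] by simp
  next
    case False
    have "scaleC_blinfun (inverse z) (scaleC_blinfun z f) = f"
      using False by (intro blinfun_eqI) (simp add: scaleC_blinfun.rep_eq scaleC_scaleC)
    then have "norm f \<le> inverse (cmod z) * norm (scaleC_blinfun z f)"
      using le[of "inverse z" "scaleC_blinfun z f"] by (simp add: norm_inverse)
    then show ?thesis
      using le[of z f] False by (simp add: field_simps)
  qed
qed

lemma eq_zero_of_star_mult_eq_zero:
  fixes d :: "'a::cstar_algebra"
  shows "star d * d = 0 \<Longrightarrow> d = 0"
  using cstar_identity[of d] by simp

text \<open>
  Multipliers are the adjointable operators of the algebra regarded as a Hilbert module over itself,
  with inner product \<open>x\<^sup>* y\<close>. Carrying the adjoint as second component makes the involution an exchange
  of components and needs no uniqueness argument. Only real linearity is demanded of the two maps;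
  complex linearity follows from the adjoint relation.
\<close>
typedef (overloaded) ('a::cstar_algebra) multiplier =
  "{X :: ('a \<Rightarrow>\<^sub>L 'a) \<times> ('a \<Rightarrow>\<^sub>L 'a). \<forall>x y.
    star (blinfun_apply (fst X) x) * y = star x * blinfun_apply (snd X) y}"
  by (rule exI[of _ "(0, 0)"]) simp

definition op :: "'a::cstar_algebra multiplier \<Rightarrow> 'a \<Rightarrow>\<^sub>L 'a" where
  "op X = fst (Rep_multiplier X)"

definition adj_op :: "'a::cstar_algebra multiplier \<Rightarrow> 'a \<Rightarrow>\<^sub>L 'a" where
  "adj_op X = snd (Rep_multiplier X)"

text \<open>
  The value is meaningful only if the two maps are adjoint to each other.
\<close>
definition mk_multiplier :: "('a::cstar_algebra \<Rightarrow>\<^sub>L 'a) \<Rightarrow> ('a \<Rightarrow>\<^sub>L 'a) \<Rightarrow> 'a multiplier" where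
  "mk_multiplier f g = Abs_multiplier (f, g)"

lemma op_mk:
  fixes f g :: "'a::cstar_algebra \<Rightarrow>\<^sub>L 'a"
  assumes "\<And>x y. star (f x) * y = star x * g y"
  shows "op (mk_multiplier f g) = f" "adj_op (mk_multiplier f g) = g"
  using assms by (simp_all add: op_def adj_op_def mk_multiplier_def Abs_multiplier_inverse)

lemma star_op_mult: "star (op X x) * y = star x * adj_op X y"
  using Rep_multiplier[of X] by (simp add: op_def adj_op_def)

lemma star_mult_op: "star x * op X y = star (adj_op X x) * y"
  using arg_cong[OF star_op_mult[of X y x], of star] by (simp add: star_mult star_star)

lemma multiplier_eqI: "op X = op Y \<Longrightarrow> adj_op X = adj_op Y \<Longrightarrow> X = Y"
  by (simp add: op_def adj_op_def prod_eq_iff flip: Rep_multiplier_inject)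

lemma op_scaleC: "op X (z *\<^sub>C x) = z *\<^sub>C op X x"
proof -
  define d where "d = op X (z *\<^sub>C x) - z *\<^sub>C op X x"
  have "star y * op X (z *\<^sub>C x) = star y * (z *\<^sub>C op X x)" for y
    by (simp add: star_mult_op mult_scaleC_right)
  then have "star d * d = 0"
    by (simp add: d_def right_diff_distrib)
  then show ?thesis
    using eq_zero_of_star_mult_eq_zero[of d] by (simp add: d_def)
qed

lemma adj_op_scaleC: "adj_op X (z *\<^sub>C x) = z *\<^sub>C adj_op X x"
proof -
  define d where "d = adj_op X (z *\<^sub>C x) - z *\<^sub>C adj_op X x"
  have "star y * adj_op X (z *\<^sub>C x) = star y * (z *\<^sub>C adj_op X x)" for y
    by (simp add: mult_scaleC_right flip: star_op_mult)
  then have "star d * d = 0"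
    by (simp add: d_def right_diff_distrib)
  then show ?thesis
    using eq_zero_of_star_mult_eq_zero[of d] by (simp add: d_def)
qed

text \<open>
  \<open>\<parallel>T x\<parallel>\<^sup>2 = \<parallel>x\<^sup>* (T\<^sup>* T x)\<parallel>\<close>; this is the nontrivial half of the \<open>C\<^sup>*\<close>-identity for multipliers.
\<close>
lemma norm_op_sq_le:
  "(norm (op X))\<^sup>2 \<le> norm (adj_op X o\<^sub>L op X)" "(norm (adj_op X))\<^sup>2 \<le> norm (op X o\<^sub>L adj_op X)"
proof -
  have bound: "(norm f)\<^sup>2 \<le> norm (g o\<^sub>L f)"
    if adjoint: "\<And>x y. star (f x) * y = star x * g y" for f g :: "'a \<Rightarrow>\<^sub>L 'a"
  proof -
    have "norm f \<le> sqrt (norm (g o\<^sub>L f))"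
    proof (rule norm_blinfun_bound)
      fix x
      have "(norm (f x))\<^sup>2 = norm (star x * (g o\<^sub>L f) x)"
        by (simp add: adjoint flip: cstar_identity)
      also have "\<dots> \<le> norm x * (norm (g o\<^sub>L f) * norm x)"
        by (intro order.trans[OF norm_mult_ineq] mult_mono norm_blinfun) (simp_all add: norm_star)
      also have "\<dots> = (sqrt (norm (g o\<^sub>L f)) * norm x)\<^sup>2"
        by (simp add: power_mult_distrib) (simp add: power2_eq_square)
      finally show "norm (f x) \<le> sqrt (norm (g o\<^sub>L f)) * norm x"
        by (rule power2_le_imp_le) simp
    qed simp
    then show ?thesis
      by (simp add: real_le_rsqrt sqrt_ge_absD)
  qed
  show "(norm (op X))\<^sup>2 \<le> norm (adj_op X o\<^sub>L op X)"
    by (rule bound) (rule star_op_mult)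
  show "(norm (adj_op X))\<^sup>2 \<le> norm (op X o\<^sub>L adj_op X)"
    by (rule bound) (rule star_mult_op[symmetric])
qed

lemma norm_adj_op: "norm (adj_op X) = norm (op X)"
proof -
  have "(norm (op X))\<^sup>2 \<le> norm (adj_op X) * norm (op X)" "(norm (adj_op X))\<^sup>2 \<le> norm (op X) * norm (adj_op X)"
    using norm_op_sq_le[of X] norm_blinfun_compose[of "adj_op X" "op X"]
      norm_blinfun_compose[of "op X" "adj_op X"] by simp_all
  then show ?thesis
    using norm_ge_zero[of "op X"] norm_ge_zero[of "adj_op X"]
    by (cases "norm (op X) = 0 \<or> norm (adj_op X) = 0") (auto simp: power2_eq_square mult_le_0_iff)
qed

instantiation multiplier :: (cstar_algebra) complex_normed_vector
begin

definition zero_multiplier :: "'a multiplier" where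
  "zero_multiplier = mk_multiplier 0 0"

definition plus_multiplier :: "'a multiplier \<Rightarrow> 'a multiplier \<Rightarrow> 'a multiplier" where
  "plus_multiplier X Y = mk_multiplier (op X + op Y) (adj_op X + adj_op Y)"

definition minus_multiplier :: "'a multiplier \<Rightarrow> 'a multiplier \<Rightarrow> 'a multiplier" where
  "minus_multiplier X Y = mk_multiplier (op X - op Y) (adj_op X - adj_op Y)"

definition uminus_multiplier :: "'a multiplier \<Rightarrow> 'a multiplier" where
  "uminus_multiplier X = mk_multiplier (- op X) (- adj_op X)"

definition scaleR_multiplier :: "real \<Rightarrow> 'a multiplier \<Rightarrow> 'a multiplier" where
  "scaleR_multiplier r X = mk_multiplier (r *\<^sub>R op X) (r *\<^sub>R adj_op X)"

definition scaleC_multiplier :: "complex \<Rightarrow> 'a multiplier \<Rightarrow> 'a multiplier" where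
  "scaleC_multiplier z X = mk_multiplier (scaleC_blinfun z (op X)) (scaleC_blinfun (cnj z) (adj_op X))"

definition norm_multiplier :: "'a multiplier \<Rightarrow> real" where
  "norm_multiplier X = norm (op X)"

definition dist_multiplier :: "'a multiplier \<Rightarrow> 'a multiplier \<Rightarrow> real" where
  "dist_multiplier X Y = norm (X - Y)"

definition uniformity_multiplier :: "('a multiplier \<times> 'a multiplier) filter" where
  "uniformity_multiplier = (INF e\<in>{0 <..}. principal {(x, y). dist x y < e})"

definition open_multiplier :: "'a multiplier set \<Rightarrow> bool" where
  "open_multiplier S = (\<forall>x\<in>S. \<forall>\<^sub>F (x', y) in uniformity. x' = x \<longrightarrow> y \<in> S)"

definition sgn_multiplier :: "'a multiplier \<Rightarrow> 'a multiplier" where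
  "sgn_multiplier X = inverse (norm X) *\<^sub>R X"

lemma op_simps:
  "op 0 = (0 :: 'a \<Rightarrow>\<^sub>L 'a)" "op (X + Y) = op X + op Y" "op (X - Y) = op X - op Y"
  "op (- X) = - op X" "op (r *\<^sub>R X) = r *\<^sub>R op X" "op (z *\<^sub>C X) = scaleC_blinfun z (op X)"
  and adj_op_simps:
  "adj_op 0 = (0 :: 'a \<Rightarrow>\<^sub>L 'a)" "adj_op (X + Y) = adj_op X + adj_op Y"
  "adj_op (X - Y) = adj_op X - adj_op Y" "adj_op (- X) = - adj_op X"
  "adj_op (r *\<^sub>R X) = r *\<^sub>R adj_op X" "adj_op (z *\<^sub>C X) = scaleC_blinfun (cnj z) (adj_op X)"
  for X Y :: "'a multiplier"
  unfolding zero_multiplier_def plus_multiplier_def minus_multiplier_def uminus_multiplier_def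
    scaleR_multiplier_def scaleC_multiplier_def
  by (rule op_mk; simp add: star_op_mult blinfun.bilinear_simps scaleC_blinfun.rep_eq star_add
      star_diff star_minus star_scaleR star_scaleC mult_scaleC_left mult_scaleC_right algebra_simps)+

instance
proof
  fix X Y Z :: "'a multiplier" and r s :: real and z w :: complex
  show "X + Y + Z = X + (Y + Z)" "X + Y = Y + X" "0 + X = X" "- X + X = 0" "X - Y = X + - Y"
    "r *\<^sub>R (X + Y) = r *\<^sub>R X + r *\<^sub>R Y" "(r + s) *\<^sub>R X = r *\<^sub>R X + s *\<^sub>R X"
    "r *\<^sub>R s *\<^sub>R X = (r * s) *\<^sub>R X" "1 *\<^sub>R X = X"
    by (rule multiplier_eqI; simp add: op_simps adj_op_simps algebra_simps)+
  show "z *\<^sub>C (X + Y) = z *\<^sub>C X + z *\<^sub>C Y" "(z + w) *\<^sub>C X = z *\<^sub>C X + w *\<^sub>C X"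
    "z *\<^sub>C w *\<^sub>C X = (z * w) *\<^sub>C X" "r *\<^sub>R X = complex_of_real r *\<^sub>C X"
    by (rule multiplier_eqI; rule blinfun_eqI;
        simp add: op_simps adj_op_simps scaleC_blinfun.rep_eq blinfun.add_left blinfun.scaleR_left
          scaleC_add_right scaleC_add_left scaleC_scaleC scaleR_scaleC)+
  show "dist X Y = norm (X - Y)" "sgn X = inverse (norm X) *\<^sub>R X"
    by (simp_all add: dist_multiplier_def sgn_multiplier_def)
  show "uniformity = (INF e\<in>{0 <..}. principal {(x, y). dist x (y::'a multiplier) < e})"
    by (rule uniformity_multiplier_def)
  show "open S \<longleftrightarrow> (\<forall>x\<in>S. \<forall>\<^sub>F (x', y) in uniformity. x' = x \<longrightarrow> y \<in> S)" for S :: "'a multiplier set"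
    by (rule open_multiplier_def)
  show "norm X = 0 \<longleftrightarrow> X = 0"
    using norm_adj_op[of X] by (auto simp: norm_multiplier_def op_simps adj_op_simps intro: multiplier_eqI)
  show "norm (X + Y) \<le> norm X + norm Y" "norm (r *\<^sub>R X) = \<bar>r\<bar> * norm X" "norm (z *\<^sub>C X) = cmod z * norm X"
    by (simp_all add: norm_multiplier_def op_simps norm_triangle_ineq norm_scaleC_blinfun)
qed

end

instance multiplier :: (cstar_algebra) complex_banach
proof
  fix X :: "nat \<Rightarrow> 'a multiplier" assume X: "Cauchy X"
  have "Cauchy (\<lambda>n. op (X n))" "Cauchy (\<lambda>n. adj_op (X n))"
    using X norm_adj_op[of "X _ - X _"]
    by (simp_all add: Cauchy_def dist_norm norm_multiplier_def op_simps adj_op_simps)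
  then obtain f g where f: "(\<lambda>n. op (X n)) \<longlonglongrightarrow> f" and g: "(\<lambda>n. adj_op (X n)) \<longlonglongrightarrow> g"
    by (meson Cauchy_convergent convergentD)
  have "star (f x) * y = star x * g y" for x y
  proof (rule LIMSEQ_unique)
    show "(\<lambda>n. star (op (X n) x) * y) \<longlonglongrightarrow> star (f x) * y"
      by (intro tendsto_intros bounded_linear.tendsto[OF bounded_linear_star] f)
    show "(\<lambda>n. star (op (X n) x) * y) \<longlonglongrightarrow> star x * g y"
      unfolding star_op_mult by (intro tendsto_intros g)
  qed
  then have "op (mk_multiplier f g) = f"
    by (rule op_mk)
  then obtain Y where "op Y = f"
    by blast
  then have "(\<lambda>n. norm (X n - Y)) \<longlonglongrightarrow> 0"
    using tendsto_norm_zero[OF LIM_zero[OF f]] by (simp add: norm_multiplier_def op_simps)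
  then have "X \<longlonglongrightarrow> Y"
    by (rule LIM_zero_cancel[OF tendsto_norm_zero_cancel])
  then show "convergent X"
    by (rule convergentI)
qed

instantiation multiplier :: (cstar_algebra) unital_cstar_algebra
begin

definition one_multiplier :: "'a multiplier" where
  "one_multiplier = mk_multiplier id_blinfun id_blinfun"

definition times_multiplier :: "'a multiplier \<Rightarrow> 'a multiplier \<Rightarrow> 'a multiplier" where
  "times_multiplier X Y = mk_multiplier (op X o\<^sub>L op Y) (adj_op Y o\<^sub>L adj_op X)"

definition star_multiplier :: "'a multiplier \<Rightarrow> 'a multiplier" where
  "star_multiplier X = mk_multiplier (adj_op X) (op X)"

lemma op_mult_simps:
  "op 1 = (id_blinfun :: 'a \<Rightarrow>\<^sub>L 'a)" "op (X * Y) = op X o\<^sub>L op Y" "op (star X) = adj_op X"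
  "adj_op 1 = (id_blinfun :: 'a \<Rightarrow>\<^sub>L 'a)" "adj_op (X * Y) = adj_op Y o\<^sub>L adj_op X" "adj_op (star X) = op X"
  for X Y :: "'a multiplier"
  unfolding one_multiplier_def times_multiplier_def star_multiplier_def
  by (rule op_mk; simp add: star_op_mult star_mult_op)+

instance
proof
  fix X Y Z :: "'a multiplier" and r :: real and z :: complex
  show "X * Y * Z = X * (Y * Z)" "(X + Y) * Z = X * Z + Y * Z" "X * (Y + Z) = X * Y + X * Z"
    "r *\<^sub>R X * Y = r *\<^sub>R (X * Y)" "X * r *\<^sub>R Y = r *\<^sub>R (X * Y)" "1 * X = X" "X * 1 = X"
    "z *\<^sub>C X * Y = z *\<^sub>C (X * Y)" "X * z *\<^sub>C Y = z *\<^sub>C (X * Y)"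
    "star (X + Y) = star X + star Y" "star (z *\<^sub>C X) = cnj z *\<^sub>C star X"
    "star (X * Y) = star Y * star X" "star (star X) = X"
    by (rule multiplier_eqI; rule blinfun_eqI;
        simp add: op_simps adj_op_simps op_mult_simps scaleC_blinfun.rep_eq op_scaleC adj_op_scaleC
          blinfun.bilinear_simps)+
  show "norm (X * Y) \<le> norm X * norm Y"
    by (simp add: norm_multiplier_def op_mult_simps norm_blinfun_compose)
  show "norm (star X * X) = (norm X)\<^sup>2"
    using norm_op_sq_le(1)[of X] norm_blinfun_compose[of "adj_op X" "op X"]
    by (simp add: norm_multiplier_def op_mult_simps norm_adj_op power2_eq_square)
qed

end

definition left_mult :: "'a::cstar_algebra \<Rightarrow> 'a multiplier" where
  "left_mult a = mk_multiplier (blinfun_mult_right a) (blinfun_mult_right (star a))"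

lemma op_left_mult:
  "op (left_mult a) = blinfun_mult_right a" "adj_op (left_mult a) = blinfun_mult_right (star a)"
  unfolding left_mult_def
  by (rule op_mk; simp add: blinfun_mult_right.rep_eq star_mult mult.assoc)+

text \<open>
  The \<open>C\<^sup>*\<close>-identity shows that left multiplication by \<open>a\<close> attains its norm at \<open>a\<^sup>*\<close>. So every
  \<open>C\<^sup>*\<close>-algebra sits isometrically in a unital one.
\<close>
lemma norm_left_mult: "norm (left_mult a) = norm a"
proof (rule antisym)
  show "norm (left_mult a) \<le> norm a"
    unfolding norm_multiplier_def op_left_mult
    by (rule norm_blinfun_bound) (simp_all add: blinfun_mult_right.rep_eq norm_mult_ineq)
  have "norm (a * star a) \<le> norm (left_mult a) * norm (star a)"
    using norm_blinfun[of "blinfun_mult_right a" "star a"]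
    by (simp add: norm_multiplier_def op_left_mult blinfun_mult_right.rep_eq)
  then have "norm a * norm a \<le> norm (left_mult a) * norm a"
    using cstar_identity[of "star a"] by (simp add: star_star norm_star power2_eq_square)
  then show "norm a \<le> norm (left_mult a)"
    by (cases "a = 0") (auto simp: norm_ge_zero)
qed

lemma left_mult_hom:
  "left_mult (a + b) = left_mult a + left_mult b"
  "left_mult (a * b) = left_mult a * left_mult b"
  "left_mult (star a) = star (left_mult a)"
  by (rule multiplier_eqI; rule blinfun_eqI;
      simp add: op_simps adj_op_simps op_mult_simps op_left_mult blinfun_mult_right.rep_eq blinfun.add_left star_add star_mult star_star distrib_right mult.assoc)+

text \<open>
  Monotonicity of the norm on positive elements, transferred from the multiplier algebra.
\<close>
lemma norm_sq_le_norm_sum: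
  fixes b s :: "'a::cstar_algebra"
  shows "(norm b)\<^sup>2 \<le> norm (star b * b + star s * s)"
  using norm_sq_le_norm_sum_unital[of "left_mult b" "left_mult s"]
  by (simp add: norm_left_mult flip: left_mult_hom)

section \<open>Adjointable operators and range inclusion\<close>

text \<open>
  The correspondence \<open>f y \<mapsto> g y\<close> is Lipschitz, so it extends to the closure of the range of \<open>f\<close> by
  completeness. The value \<open>w\<close> of the extension comes with a sequence that realizes it.
\<close>
lemma limit_through_bounded_relation:
  fixes f g :: "'i \<Rightarrow> 'e::banach"
  assumes bound: "\<And>y z. norm (g y - g z) \<le> K * norm (f y - f z)"
    and m: "m \<in> closure (range f)"
  obtains y w where "(\<lambda>n. f (y n)) \<longlonglongrightarrow> m" "(\<lambda>n. g (y n)) \<longlonglongrightarrow> w"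
proof -
  obtain s where s: "\<And>n. s n \<in> range f" "s \<longlonglongrightarrow> m"
    using m by (auto simp: closure_sequential)
  then have "\<forall>n. \<exists>y. f y = s n"
    by (metis imageE)
  then obtain y where y: "\<And>n. f (y n) = s n"
    by metis
  have "Cauchy (\<lambda>n. g (y n))"
  proof (rule CauchyI)
    fix e :: real assume e: "0 < e"
    have "Cauchy s"
      using s(2) by (rule LIMSEQ_imp_Cauchy)
    then obtain N where N: "\<And>i j. i \<ge> N \<Longrightarrow> j \<ge> N \<Longrightarrow> norm (s i - s j) < e / (\<bar>K\<bar> + 1)"
      using e CauchyD[of s "e / (\<bar>K\<bar> + 1)"] by auto
    have "norm (g (y i) - g (y j)) < e" if "i \<ge> N" "j \<ge> N" for i j
    proof -
      have "norm (g (y i) - g (y j)) \<le> K * norm (s i - s j)"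
        using bound[of "y i" "y j"] by (simp add: y)
      also have "\<dots> \<le> (\<bar>K\<bar> + 1) * norm (s i - s j)"
        by (intro mult_right_mono) auto
      also have "\<dots> < (\<bar>K\<bar> + 1) * (e / (\<bar>K\<bar> + 1))"
        by (intro mult_strict_left_mono N that) auto
      finally show ?thesis by simp
    qed
    then show "\<exists>N. \<forall>i\<ge>N. \<forall>j\<ge>N. norm (g (y i) - g (y j)) < e"
      by blast
  qed
  then obtain w where "(\<lambda>n. g (y n)) \<longlonglongrightarrow> w"
    by (meson Cauchy_convergent convergentD)
  moreover have "(\<lambda>n. f (y n)) \<longlonglongrightarrow> m"
    using s(2) by (simp add: y)
  ultimately show ?thesis
    by (rule that[rotated])
qed

lemma orthogonally_complemented_decompose:
  assumes "orthogonally_complemented act ip M"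
  obtains m n where "x = m + n" "m \<in> M" "n \<in> orth_compl ip M"
proof -
  have "x \<in> {m + n |m n. m \<in> M \<and> n \<in> orth_compl ip M}"
    using assms by (simp add: orthogonally_complemented_def)
  then show ?thesis
    using that by blast
qed

context hilbert_module
begin

lemma ip_add_left: "ip (x + y) z = ip x z + ip y z"
  using arg_cong[OF ip_add_right[of z x y], of star] by (simp add: star_ip star_add)

lemma ip_scaleC_left: "ip (c *\<^sub>C x) y = cnj c *\<^sub>C ip x y"
  using arg_cong[OF ip_scaleC_right[of y c x], of star] by (simp add: star_ip star_scaleC)

lemma ip_scaleR_left: "ip (r *\<^sub>R x) y = r *\<^sub>R ip x y"
  by (simp add: scaleR_scaleC ip_scaleC_left)

lemma ip_scaleR_right: "ip x (r *\<^sub>R y) = r *\<^sub>R ip x y"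
  by (simp add: scaleR_scaleC ip_scaleC_right)

lemma ip_diff_left: "ip (x - y) z = ip x z - ip y z"
  using ip_add_left[of "x - y" y z] by simp

lemma ip_diff_right: "ip x (y - z) = ip x y - ip x z"
  using ip_add_right[of x "y - z" z] by simp

lemma norm_ip_self: "norm (ip x x) = (norm x)\<^sup>2"
  by (simp add: norm_eq_sqrt_ip[of x])

text \<open>
  A weak form of the Cauchy--Schwarz inequality, sufficient for continuity. It follows from
  the triangle inequality by polarization: the sum and the difference of
  \<open>\<langle>x, y\<rangle>\<close> and \<open>\<langle>y, x\<rangle>\<close> are combinations of values \<open>\<langle>v, v\<rangle>\<close>, of norm \<open>\<parallel>v\<parallel>\<^sup>2\<close>.
\<close>
lemma norm_ip_le: "norm (ip x y) \<le> norm x * norm y * 4"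
proof -
  have symmetric: "norm (ip x y + ip y x) \<le> (norm x + norm y)\<^sup>2" for x y
  proof -
    have "2 *\<^sub>R (ip x y + ip y x) = ip (x + y) (x + y) - ip (x - y) (x - y)"
      by (simp add: ip_add_left ip_add_right ip_diff_left ip_diff_right algebra_simps scaleR_2)
    moreover have "norm (ip (x + y) (x + y) - ip (x - y) (x - y))
        \<le> (norm (x + y))\<^sup>2 + (norm (x - y))\<^sup>2"
      by (intro order.trans[OF norm_triangle_ineq4]) (simp add: norm_ip_self)
    moreover have "\<dots> \<le> (norm x + norm y)\<^sup>2 + (norm x + norm y)\<^sup>2"
      using norm_triangle_ineq[of x y] norm_triangle_ineq4[of x y]
      by (intro add_mono power_mono) auto
    ultimately have "norm (2 *\<^sub>R (ip x y + ip y x)) \<le> 2 * (norm x + norm y)\<^sup>2"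
      by (simp only: mult_2)
    then show ?thesis
      by simp
  qed
  have polar: "norm (ip x y) \<le> (norm x + norm y)\<^sup>2" for x y
  proof -
    have "norm (\<i> *\<^sub>C (ip x y - ip y x)) \<le> (norm x + norm y)\<^sup>2"
      using symmetric[of x "\<i> *\<^sub>C y"]
      by (simp add: ip_scaleC_left ip_scaleC_right norm_scaleC scaleC_minus_left scaleC_diff_right)
    moreover have "2 *\<^sub>R ip x y = (ip x y + ip y x) + (ip x y - ip y x)"
      by (simp add: scaleR_2)
    then have "2 * norm (ip x y) \<le> norm (ip x y + ip y x) + norm (ip x y - ip y x)"
      using norm_triangle_ineq[of "ip x y + ip y x" "ip x y - ip y x"]
      by (metis abs_numeral norm_scaleR)
    ultimately show ?thesis
      using symmetric[of x y] by (simp add: norm_scaleC)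
  qed
  show ?thesis
  proof (cases "x = 0 \<or> y = 0")
    case True
    then show ?thesis
      using ip_scaleR_left[of 0 x y] ip_scaleR_right[of x 0 y] by auto
  next
    case False
    have "norm (ip ((1 / norm x) *\<^sub>R x) ((1 / norm y) *\<^sub>R y)) \<le> 4"
      using polar[of "(1 / norm x) *\<^sub>R x" "(1 / norm y) *\<^sub>R y"] False by simp
    then show ?thesis
      using False by (simp add: ip_scaleR_left ip_scaleR_right field_simps)
  qed
qed

sublocale ip: bounded_bilinear ip
proof
  show "\<exists>K. \<forall>x y. norm (ip x y) \<le> norm x * norm y * K"
    using norm_ip_le by blast
qed (simp_all add: ip_add_left ip_add_right ip_scaleR_left ip_scaleR_right)

lemma ip_ext: "(\<And>z. ip z x = ip z y) \<Longrightarrow> x = y"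
  using ip_self_eq_0[of "x - y"] by (simp add: ip.diff_right)

lemma is_adjointD: "is_adjoint ip T S \<Longrightarrow> ip (T x) y = ip x (S y)"
  by (simp add: is_adjoint_def)

lemma is_adjoint_sym:
  assumes "is_adjoint ip T S"
  shows "is_adjoint ip S T"
  unfolding is_adjoint_def using assms by (metis is_adjoint_def star_ip)

text \<open>
  The functionals \<open>\<langle>T x, -\<rangle>\<close> for \<open>x\<close> in the unit ball are pointwise bounded, since \<open>\<langle>T x, y\<rangle> = \<langle>x, S y\<rangle>\<close>.
  A uniform bound, evaluated at \<open>y = T x\<close>, bounds \<open>T\<close>.
\<close>
lemma bounded_linear_of_is_adjoint:
  assumes adjoint: "is_adjoint ip T S"
  shows "bounded_linear T"
proof -
  have swap: "ip z (T x) = ip (S z) x" for x z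
    using is_adjointD[OF is_adjoint_sym[OF adjoint]] by simp
  define F where "F = (\<lambda>x. ip (T x)) ` cball 0 1"
  have "\<exists>K. \<forall>f\<in>F. norm (f y) \<le> K" for y
  proof (intro exI ballI)
    fix f assume "f \<in> F"
    then obtain x where x: "norm x \<le> 1" "f = ip (T x)"
      by (auto simp: F_def)
    have "norm (f y) \<le> norm x * norm (S y) * 4"
      using norm_ip_le[of x "S y"] by (simp add: x(2) is_adjointD[OF adjoint])
    also have "\<dots> \<le> 1 * norm (S y) * 4"
      using x(1) by (intro mult_right_mono) auto
    finally show "norm (f y) \<le> norm (S y) * 4" by simp
  qed
  moreover have "bounded_linear f" if "f \<in> F" for f
    using that ip.bounded_linear_right unfolding F_def by blast
  ultimately obtain K where K: "\<forall>f\<in>F. \<forall>y. norm (f y) \<le> K * norm y"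
    using uniform_boundedness[of F] by blast
  have unit: "norm (T x) \<le> \<bar>K\<bar>" if "norm x \<le> 1" for x
  proof (cases "T x = 0")
    case False
    have "norm (ip (T x) (T x)) \<le> K * norm (T x)"
      using K that unfolding F_def by simp
    then show ?thesis
      using False by (simp add: norm_ip_self power2_eq_square)
  qed auto
  show ?thesis
  proof (rule bounded_linear_intro)
    show "T (x + y) = T x + T y" for x y
      by (rule ip_ext) (simp add: swap ip.add_right)
    show scale: "T (r *\<^sub>R x) = r *\<^sub>R T x" for r x
      by (rule ip_ext) (simp add: swap ip.scaleR_right)
    show "norm (T x) \<le> norm x * \<bar>K\<bar>" for x
    proof (cases "x = 0")
      case True
      then show ?thesis using scale[of 0 0] by simp
    next
      case False
      then show ?thesis
        using unit[of "(1 / norm x) *\<^sub>R x"] by (simp add: scale field_simps)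
    qed
  qed
qed

text \<open>
  If \<open>B x = A u\<close> then \<open>\<langle>B\<^sup>* y, x\<rangle> = \<langle>A\<^sup>* y, u\<rangle>\<close>, so the functionals \<open>\<langle>B\<^sup>* y, -\<rangle>\<close> with \<open>\<parallel>A\<^sup>* y\<parallel> \<le> 1\<close> are pointwise
  bounded. A uniform bound, evaluated at \<open>x = B\<^sup>* y\<close>, bounds \<open>B\<^sup>* y\<close>.
\<close>
lemma adjoint_dominated_of_range_subset:
  assumes A: "is_adjoint ip A A'" and B: "is_adjoint ip B B'"
    and range: "range B \<subseteq> range A"
  shows "\<exists>K. \<forall>y. norm (B' y) \<le> K * norm (A' y)"
proof -
  interpret A': bounded_linear A'
    by (rule bounded_linear_of_is_adjoint[OF is_adjoint_sym[OF A]])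
  interpret B': bounded_linear B'
    by (rule bounded_linear_of_is_adjoint[OF is_adjoint_sym[OF B]])
  define F where "F = (\<lambda>y. ip (B' y)) ` {y. norm (A' y) \<le> 1}"
  have "\<exists>K. \<forall>f\<in>F. norm (f x) \<le> K" for x
  proof -
    obtain u where u: "B x = A u"
      using range by blast
    have "norm (f x) \<le> norm u * 4" if f: "f \<in> F" for f
    proof -
      obtain y where y: "norm (A' y) \<le> 1" "f = ip (B' y)"
        using f unfolding F_def by blast
      have "f x = ip (A' y) u"
        using is_adjointD[OF is_adjoint_sym[OF A]] is_adjointD[OF is_adjoint_sym[OF B]]
        by (simp add: y(2) u)
      then have "norm (f x) \<le> norm (A' y) * norm u * 4"
        using norm_ip_le by simp
      also have "\<dots> \<le> 1 * norm u * 4"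
        using y(1) by (intro mult_right_mono) auto
      finally show ?thesis by simp
    qed
    then show ?thesis by blast
  qed
  moreover have "bounded_linear f" if "f \<in> F" for f
    using that ip.bounded_linear_right unfolding F_def by blast
  ultimately obtain K where K: "\<forall>f\<in>F. \<forall>x. norm (f x) \<le> K * norm x"
    using uniform_boundedness[of F] by blast
  have unit: "norm (B' y) \<le> \<bar>K\<bar>" if "norm (A' y) \<le> 1" for y
  proof (cases "B' y = 0")
    case False
    have "norm (ip (B' y) (B' y)) \<le> K * norm (B' y)"
      using K that unfolding F_def by simp
    then show ?thesis
      using False by (simp add: norm_ip_self power2_eq_square)
  qed auto
  have "norm (B' y) \<le> \<bar>K\<bar> * norm (A' y)" for y
  proof (cases "A' y = 0")
    case True
    \<comment> \<open>All multiples of \<open>y\<close> are admissible here, so \<open>B' y\<close> has arbitrarily large multiples below \<open>\<bar>K\<bar>\<close>.\<close>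
    have "r * norm (B' y) \<le> \<bar>K\<bar>" if "0 \<le> r" for r
      using unit[of "r *\<^sub>R y"] True that by (simp add: A'.scaleR B'.scaleR)
    from this[of "(\<bar>K\<bar> + 1) / norm (B' y)"] have "B' y = 0"
      by (cases "B' y = 0") auto
    then show ?thesis by simp
  next
    case False
    then show ?thesis
      using unit[of "(1 / norm (A' y)) *\<^sub>R y"]
      by (simp add: A'.scaleR B'.scaleR field_simps)
  qed
  then show ?thesis by blast
qed

lemma adjoint_eq_zero_on_orth_compl:
  assumes A: "is_adjoint ip A A'" and n: "n \<in> orth_compl ip (closure (range A'))"
  shows "A n = 0"
proof (rule ip_ext)
  fix z
  have "A' z \<in> closure (range A')"
    by (rule closure_subset[THEN subsetD]) simp
  then show "ip z (A n) = ip z 0"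
    using n is_adjointD[OF is_adjoint_sym[OF A], of z n] by (simp add: orth_compl_def ip.zero_right)
qed

lemma preimage_in_complemented_closure:
  assumes A: "is_adjoint ip A A'"
    and compl: "orthogonally_complemented act ip (closure (range A'))"
    and y: "y \<in> range A"
  shows "\<exists>u\<in>closure (range A'). A u = y"
proof -
  interpret A: bounded_linear A
    by (rule bounded_linear_of_is_adjoint[OF A])
  obtain v where v: "y = A v"
    using y by blast
  obtain m n where mn: "v = m + n" "m \<in> closure (range A')" "n \<in> orth_compl ip (closure (range A'))"
    using orthogonally_complemented_decompose[OF compl] by blast
  have "A m = y"
    using adjoint_eq_zero_on_orth_compl[OF A mn(3)] by (simp add: v mn(1) A.add)
  then show ?thesis
    using mn(2) by blast
qed

text \<open>
  Adjointability of \<open>X\<close> only requires, for each \<open>z\<close>, some \<open>w\<close> with \<open>\<langle>X x, z\<rangle> = \<langle>x, w\<rangle>\<close> for all \<open>x\<close>; an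
  \<open>X\<close> chosen pointwise thus becomes linear and bounded by itself. For \<open>z = m + n\<close> with \<open>m\<close> the limit of
  \<open>A\<^sup>* y\<^sub>k\<close>, the limit of \<open>B\<^sup>* y\<^sub>k\<close> does it, because \<open>\<langle>X x, A\<^sup>* y\<rangle> = \<langle>A (X x), y\<rangle> = \<langle>x, B\<^sup>* y\<rangle>\<close>.
\<close>
lemma adjointable_solution_of_range_subset:
  assumes A: "is_adjoint ip A A'" and B: "is_adjoint ip B B'"
    and compl: "orthogonally_complemented act ip (closure (range A'))"
    and range: "range B \<subseteq> range A"
  shows "\<exists>X\<in>adjointable_ops ip. A \<circ> X = B"
proof -
  interpret A': bounded_linear A'
    by (rule bounded_linear_of_is_adjoint[OF is_adjoint_sym[OF A]])
  interpret B': bounded_linear B'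
    by (rule bounded_linear_of_is_adjoint[OF is_adjoint_sym[OF B]])
  let ?M = "closure (range A')"
  have "\<forall>x. \<exists>u\<in>?M. A u = B x"
    using preimage_in_complemented_closure[OF A compl] range by blast
  then obtain X where X: "\<And>x. X x \<in> ?M" "\<And>x. A (X x) = B x"
    by metis
  obtain K where K: "\<And>y. norm (B' y) \<le> K * norm (A' y)"
    using adjoint_dominated_of_range_subset[OF A B range] by blast
  have "\<exists>w. \<forall>x. ip (X x) z = ip x w" for z
  proof -
    obtain m n where mn: "z = m + n" "m \<in> ?M" "n \<in> orth_compl ip ?M"
      using orthogonally_complemented_decompose[OF compl] by blast
    have "norm (B' y - B' y') \<le> K * norm (A' y - A' y')" for y y'
      using K[of "y - y'"] by (simp add: A'.diff B'.diff)
    then obtain y w where y: "(\<lambda>k. A' (y k)) \<longlonglongrightarrow> m" "(\<lambda>k. B' (y k)) \<longlonglongrightarrow> w"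
      by (rule limit_through_bounded_relation[OF _ mn(2)])
    have "ip (X x) z = ip x w" for x
    proof -
      have "ip (X x) (A' (y k)) = ip x (B' (y k))" for k
        using is_adjointD[OF A, of "X x" "y k"] is_adjointD[OF B, of x "y k"] by (simp add: X(2))
      moreover have "(\<lambda>k. ip (X x) (A' (y k))) \<longlonglongrightarrow> ip (X x) m"
        by (intro ip.tendsto tendsto_const y)
      moreover have "(\<lambda>k. ip x (B' (y k))) \<longlonglongrightarrow> ip x w"
        by (intro ip.tendsto tendsto_const y)
      ultimately have "ip (X x) m = ip x w"
        by (simp only: LIMSEQ_unique)
      moreover have "ip (X x) n = 0"
        using mn(3) X(1) by (simp add: orth_compl_def)
      ultimately show ?thesis
        by (simp add: mn(1) ip.add_right)
    qed
    then show ?thesis by blast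
  qed
  then obtain S where "\<And>x z. ip (X x) z = ip x (S z)"
    by metis
  then have "X \<in> adjointable_ops ip"
    by (auto simp: adjointable_ops_def is_adjoint_def)
  then show ?thesis
    using X(2) by (intro bexI[of _ X]) auto
qed

text \<open>
  With \<open>c > \<parallel>X X\<^sup>*\<parallel>\<close> the operator \<open>1 - X X\<^sup>* / c\<close> has a self-adjoint square root \<open>1 - Y\<close>, and
  \<open>S = \<surd>c (1 - Y) A\<^sup>*\<close> satisfies \<open>S\<^sup>* S = c A A\<^sup>* - A X X\<^sup>* A\<^sup>*\<close>.
\<close>
lemma op_le_of_factorization:
  assumes A: "is_adjoint ip A A'" and X: "is_adjoint ip X X'"
  shows "\<exists>c>0. op_le ip (\<lambda>x. A (X (X' (A' x)))) (\<lambda>x. c *\<^sub>R A (A' x))"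
proof -
  interpret A: bounded_linear A
    by (rule bounded_linear_of_is_adjoint[OF A])
  define G where "G = Blinfun X o\<^sub>L Blinfun X'"
  have G: "G x = X (X' x)" for x
    by (simp add: G_def bounded_linear_Blinfun_apply bounded_linear_of_is_adjoint[OF X]
        bounded_linear_of_is_adjoint[OF is_adjoint_sym[OF X]])
  define c where "c = norm G + 1"
  have c: "c > 0"
    by (simp add: c_def add_nonneg_pos)
  define h where "h = (1 / c) *\<^sub>R G"
  have "norm h < 1"
    using c by (simp add: h_def) (simp add: c_def)
  define C where "C = {Y :: 'e \<Rightarrow>\<^sub>L 'e. \<forall>x y. ip (Y x) y = ip x (Y y)}"
  have C_Inter: "C = (\<Inter>x. \<Inter>y. {Y. ip (blinfun_apply Y x) y = ip x (blinfun_apply Y y)})"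
    by (auto simp: C_def)
  have "closed C"
    unfolding C_Inter
    by (intro closed_INT ballI closed_Collect_eq)
      (rule ip.continuous_on continuous_on_const linear_continuous_on blinfun.bounded_linear_left)+
  moreover have "0 \<in> C"
    by (simp add: C_def ip.zero_left ip.zero_right)
  moreover have "(1/2) *\<^sub>R (h + (Y o\<^sub>L Y)) \<in> C" if "Y \<in> C" for Y
  proof -
    have "ip (Y (Y x)) y = ip x (Y (Y y))" for x y
      using that by (simp add: C_def)
    moreover have "ip (G x) y = ip x (G y)" for x y
      using is_adjointD[OF X, of "X' x" y] is_adjointD[OF is_adjoint_sym[OF X], of x "X' y"]
        is_adjointD[OF is_adjoint_sym[OF X], of x "X (X' y)"] is_adjointD[OF is_adjoint_sym[OF X], of x "X' y"]
      by (simp add: G)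
    ultimately show ?thesis
      by (simp add: C_def h_def blinfun.add_left blinfun.scaleR_left ip.add_left ip.add_right
          ip.scaleR_left ip.scaleR_right)
  qed
  ultimately obtain Y where Y: "Y \<in> C" "2 *\<^sub>R Y = h + (Y o\<^sub>L Y)"
    using quadratic_fixpoint[OF bounded_bilinear_blinfun_compose norm_blinfun_compose \<open>norm h < 1\<close>, of C]
    by metis
  have Y_sa: "ip (Y x) y = ip x (Y y)" for x y
    using Y(1) by (simp add: C_def)
  have Y_eq: "Y x + Y x = (1 / c) *\<^sub>R X (X' x) + Y (Y x)" for x
    using arg_cong[OF Y(2), of "\<lambda>f. blinfun_apply f x"]
    by (simp add: scaleR_2 blinfun.bilinear_simps h_def G)
  define S where "S = (\<lambda>x. sqrt c *\<^sub>R (A' x - Y (A' x)))"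
  define S' where "S' = (\<lambda>y. sqrt c *\<^sub>R A (y - Y y))"
  have adj_S: "is_adjoint ip S S'"
    unfolding is_adjoint_def S_def S'_def
    using is_adjointD[OF is_adjoint_sym[OF A]]
    by (simp add: ip.scaleR_left ip.scaleR_right ip.diff_left ip.diff_right A.diff Y_sa)
  have "S' (S x) = c *\<^sub>R A (A' x) - A (X (X' (A' x)))" for x
  proof -
    define z where "z = A' x"
    have "Y (Y z) = Y z + Y z - (1 / c) *\<^sub>R X (X' z)"
      by (simp add: Y_eq)
    then have eq: "(z - Y z) - Y (z - Y z) = z - (1 / c) *\<^sub>R X (X' z)"
      by (simp add: blinfun.diff_right)
    have "S' (S x) = c *\<^sub>R A ((z - Y z) - Y (z - Y z))"
    proof -
      define v where "v = z - Y z"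
      have "S' (S x) = sqrt c *\<^sub>R A (sqrt c *\<^sub>R v - Y (sqrt c *\<^sub>R v))"
        by (simp only: S_def S'_def z_def v_def)
      also have "sqrt c *\<^sub>R v - Y (sqrt c *\<^sub>R v) = sqrt c *\<^sub>R (v - Y v)"
        by (simp only: blinfun.scaleR_right scaleR_diff_right)
      finally show ?thesis
        using c by (simp only: A.scaleR scaleR_scaleR v_def) simp
    qed
    also have "\<dots> = c *\<^sub>R A (z - (1 / c) *\<^sub>R X (X' z))"
      by (simp only: eq)
    finally show ?thesis
      using c by (simp add: z_def A.diff A.scaleR scaleR_diff_right)
  qed
  then have "(\<lambda>x. c *\<^sub>R A (A' x) - A (X (X' (A' x)))) = adj ip S \<circ> S"
    unfolding adj_eqI[OF adj_S] by (intro ext) simp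
  moreover have "S \<in> adjointable_ops ip"
    using adj_S by (auto simp: adjointable_ops_def)
  ultimately show ?thesis
    unfolding op_le_def positive_op_def using c by (intro exI[of _ c] conjI bexI[of _ S])
qed

text \<open>
  \<open>c \<langle>A\<^sup>* x, A\<^sup>* x\<rangle> = \<langle>B\<^sup>* x, B\<^sup>* x\<rangle> + \<langle>S x, S x\<rangle>\<close> for some \<open>S\<close>, and the norm is monotone on positive elements.
\<close>
lemma adjoint_dominated_of_op_le:
  assumes A: "is_adjoint ip A A'" and B: "is_adjoint ip B B'"
    and le: "op_le ip (\<lambda>x. B (B' x)) (\<lambda>x. c *\<^sub>R A (A' x))" and c: "0 < c"
  shows "norm (B' x) \<le> sqrt c * norm (A' x)"
proof -
  obtain S where S: "S \<in> adjointable_ops ip" "(\<lambda>x. c *\<^sub>R A (A' x) - B (B' x)) = adj ip S \<circ> S"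
    using le by (auto simp: op_le_def positive_op_def)
  have "c *\<^sub>R ip (A' x) (A' x) = ip x (c *\<^sub>R A (A' x))"
    using is_adjointD[OF is_adjoint_sym[OF A]] by (simp add: ip.scaleR_right)
  also have "c *\<^sub>R A (A' x) = B (B' x) + adj ip S (S x)"
    using fun_cong[OF S(2), of x] by (simp add: algebra_simps)
  also have "ip x \<dots> = ip (B' x) (B' x) + ip (S x) (S x)"
    using is_adjointD[OF is_adjoint_sym[OF B]] is_adjointD[OF is_adjoint_adj[OF S(1)]]
    by (simp add: ip.add_right)
  finally have sum: "c *\<^sub>R ip (A' x) (A' x) = ip (B' x) (B' x) + ip (S x) (S x)" .
  obtain b s where bs: "ip (B' x) (B' x) = star b * b" "ip (S x) (S x) = star s * s"
    using ip_self_positive by (meson positive_element_def)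
  have "(norm (B' x))\<^sup>2 = (norm b)\<^sup>2"
    using norm_ip_self[of "B' x"] by (simp add: bs cstar_identity)
  also have "\<dots> \<le> norm (c *\<^sub>R ip (A' x) (A' x))"
    using norm_sq_le_norm_sum[of b s] by (simp add: sum bs)
  also have "\<dots> = (sqrt c * norm (A' x))\<^sup>2"
    using c by (simp add: norm_ip_self power_mult_distrib)
  finally show ?thesis
    by (rule power2_le_imp_le) (use c in auto)
qed

text \<open>
  On vectors \<open>A\<^sup>* y\<close> one has \<open>\<langle>u, A\<^sup>* y\<rangle> = \<langle>B\<^sup>* z, B\<^sup>* y\<rangle>\<close>, which is controlled by \<open>\<parallel>B\<^sup>* z\<parallel> \<parallel>A\<^sup>* y\<parallel>\<close>. The resulting
  bound for \<open>\<langle>u, -\<rangle>\<close> extends to the closure, which contains \<open>u\<close> itself. The factor 4 is that of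
  \<open>norm_ip_le\<close>.
\<close>
lemma norm_le_of_preimage_in_closure:
  assumes A: "is_adjoint ip A A'" and B: "is_adjoint ip B B'"
    and K: "\<And>x. norm (B' x) \<le> K * norm (A' x)"
    and u: "u \<in> closure (range A')" "A u = B (B' z)"
    and K_nonneg: "0 \<le> K"
  shows "norm u \<le> 4 * K * norm (B' z)"
proof -
  define D where "D = {v. norm (ip u v) \<le> 4 * K * norm (B' z) * norm v}"
  have "A' y \<in> D" for y
  proof -
    have "ip u (A' y) = ip (B' z) (B' y)"
      using is_adjointD[OF A, of u y] is_adjointD[OF B, of "B' z" y] u(2) by simp
    then have "norm (ip u (A' y)) \<le> norm (B' z) * norm (B' y) * 4"
      using norm_ip_le[of "B' z" "B' y"] by simp
    also have "\<dots> \<le> norm (B' z) * (K * norm (A' y)) * 4"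
      by (intro mult_right_mono mult_left_mono K) auto
    finally show ?thesis
      by (simp add: D_def mult_ac)
  qed
  moreover have "closed D"
    unfolding D_def
    by (rule closed_Collect_le)
      (intro continuous_on_norm continuous_on_mult_left continuous_on_id linear_continuous_on
        ip.bounded_linear_right)+
  ultimately have "closure (range A') \<subseteq> D"
    by (intro closure_minimal) auto
  then have "norm u * norm u \<le> 4 * K * norm (B' z) * norm u"
    using u(1) by (auto simp: D_def norm_ip_self power2_eq_square)
  then show ?thesis
    using K_nonneg by (cases "u = 0") auto
qed

text \<open>
  A preimage \<open>Y z\<close> of \<open>B B\<^sup>* z\<close> under \<open>A\<close>, chosen in the closure of the range of \<open>A\<^sup>*\<close>, depends
  Lipschitz-continuously on \<open>B\<^sup>* z\<close>. If \<open>B\<^sup>* z\<^sub>k\<close> converges to \<open>m\<close>, then \<open>Y z\<^sub>k\<close> converges to a preimage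
  of \<open>B m\<close>.
\<close>
lemma range_subset_of_adjoint_dominated:
  assumes A: "is_adjoint ip A A'" and B: "is_adjoint ip B B'"
    and compl_A: "orthogonally_complemented act ip (closure (range A'))"
    and compl_B: "orthogonally_complemented act ip (closure (range B'))"
    and range: "range (B \<circ> B') \<subseteq> range A"
    and K: "\<And>x. norm (B' x) \<le> K * norm (A' x)" "0 \<le> K"
  shows "range B \<subseteq> range A"
proof -
  interpret A: bounded_linear A
    by (rule bounded_linear_of_is_adjoint[OF A])
  interpret B: bounded_linear B
    by (rule bounded_linear_of_is_adjoint[OF B])
  interpret B': bounded_linear B'
    by (rule bounded_linear_of_is_adjoint[OF is_adjoint_sym[OF B]])
  have "\<forall>z. \<exists>u\<in>closure (range A'). A u = B (B' z)"
    using preimage_in_complemented_closure[OF A compl_A] range by (metis comp_apply rangeI subsetD)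
  then obtain Y where Y: "\<And>z. Y z \<in> closure (range A')" "\<And>z. A (Y z) = B (B' z)"
    by metis
  have sub: "closed_submodule act (closure (range A'))"
    using compl_A by (simp add: orthogonally_complemented_def)
  have bound: "norm (Y z - Y z') \<le> 4 * K * norm (B' z - B' z')" for z z'
  proof -
    have "(-1) *\<^sub>C Y z' \<in> closure (range A')"
      using sub Y(1) unfolding closed_submodule_def by blast
    then have "Y z + (-1) *\<^sub>C Y z' \<in> closure (range A')"
      using sub Y(1) unfolding closed_submodule_def by blast
    then have "Y z - Y z' \<in> closure (range A')"
      by (simp add: scaleC_minus_one)
    moreover have "A (Y z - Y z') = B (B' (z - z'))"
      by (simp add: A.diff Y(2) B.diff B'.diff)
    ultimately have "norm (Y z - Y z') \<le> 4 * K * norm (B' (z - z'))"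
      by (rule norm_le_of_preimage_in_closure[OF A B K(1) _ _ K(2)])
    then show ?thesis
      by (simp add: B'.diff)
  qed
  have "B x \<in> range A" for x
  proof -
    obtain m n where mn: "x = m + n" "m \<in> closure (range B')" "n \<in> orth_compl ip (closure (range B'))"
      using orthogonally_complemented_decompose[OF compl_B] by blast
    obtain z w where z: "(\<lambda>k. B' (z k)) \<longlonglongrightarrow> m" "(\<lambda>k. Y (z k)) \<longlonglongrightarrow> w"
      by (rule limit_through_bounded_relation[OF bound mn(2)])
    have "(\<lambda>k. A (Y (z k))) \<longlonglongrightarrow> A w" "(\<lambda>k. B (B' (z k))) \<longlonglongrightarrow> B m"
      using z by (auto intro: A.tendsto B.tendsto)
    then have "A w = B m"
      unfolding Y(2) by (rule LIMSEQ_unique)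
    then have "B x = A w"
      using adjoint_eq_zero_on_orth_compl[OF B mn(3)] by (simp add: mn(1) B.add)
    then show ?thesis by blast
  qed
  then show ?thesis by blast
qed

end

theorem theorem2p8:
  fixes act :: "'e::complex_banach \<Rightarrow> 'a::cstar_algebra \<Rightarrow> 'e"
    and ip :: "'e \<Rightarrow> 'e \<Rightarrow> 'a"
    and A B :: "'e \<Rightarrow> 'e"
  assumes "hilbert_module act ip"
    and "A \<in> adjointable_ops ip" and "B \<in> adjointable_ops ip"
    and "orthogonally_complemented act ip (closure (range (adj ip A)))"
    and "orthogonally_complemented act ip (closure (range (adj ip B)))"
  shows "((\<exists>X\<in>adjointable_ops ip. A \<circ> X = B) \<longleftrightarrow> range B \<subseteq> range A) \<and>
    (range B \<subseteq> range A \<longleftrightarrow>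
       range (B \<circ> adj ip B) \<subseteq> range A \<and>
       (\<exists>c::real. c > 0 \<and> op_le ip (B \<circ> adj ip B) (\<lambda>x. c *\<^sub>R (A \<circ> adj ip A) x)))"
proof -
  interpret hilbert_module act ip
    by (rule assms(1))
  define A' where "A' = adj ip A"
  define B' where "B' = adj ip B"
  have A: "is_adjoint ip A A'" and B: "is_adjoint ip B B'"
    unfolding A'_def B'_def by (rule is_adjoint_adj[OF assms(2)], rule is_adjoint_adj[OF assms(3)])
  have compl: "orthogonally_complemented act ip (closure (range A'))"
    "orthogonally_complemented act ip (closure (range B'))"
    using assms(4,5) by (simp_all add: A'_def B'_def)
  have solve: "\<exists>X\<in>adjointable_ops ip. A \<circ> X = B" if "range B \<subseteq> range A"
    by (rule adjointable_solution_of_range_subset[OF A B compl(1) that])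
  have "(\<exists>X\<in>adjointable_ops ip. A \<circ> X = B) \<longleftrightarrow> range B \<subseteq> range A"
    using solve by fastforce
  moreover have "range B \<subseteq> range A \<longleftrightarrow>
    range (B \<circ> B') \<subseteq> range A \<and> (\<exists>c>0. op_le ip (\<lambda>x. B (B' x)) (\<lambda>x. c *\<^sub>R A (A' x)))"
    (is "_ \<longleftrightarrow> ?range \<and> ?le")
  proof (intro iffI conjI)
    assume range: "range B \<subseteq> range A"
    then show ?range
      by auto
    obtain X where X: "X \<in> adjointable_ops ip" "A \<circ> X = B"
      using solve[OF range] by blast
    obtain X' where X': "is_adjoint ip X X'"
      using X(1) by (auto simp: adjointable_ops_def)
    have B_eq: "B x = A (X x)" for x
      using X(2) by auto
    have "is_adjoint ip B (\<lambda>x. X' (A' x))"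
      using is_adjointD[OF A] is_adjointD[OF X'] by (simp add: is_adjoint_def B_eq)
    then have "B' x = X' (A' x)" for x
      using adj_eqI by (simp add: B'_def)
    then show ?le
      using op_le_of_factorization[OF A X'] by (simp add: B_eq)
  next
    assume "?range \<and> ?le"
    then obtain c where c: "0 < c" "op_le ip (\<lambda>x. B (B' x)) (\<lambda>x. c *\<^sub>R A (A' x))" and range: ?range
      by blast
    have "norm (B' x) \<le> sqrt c * norm (A' x)" for x
      by (rule adjoint_dominated_of_op_le[OF A B c(2,1)])
    then show "range B \<subseteq> range A"
      by (rule range_subset_of_adjoint_dominated[OF A B compl range]) (use c(1) in simp)
  qed
  ultimately show ?thesis
    by (simp add: comp_def A'_def B'_def)
qed

end
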